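(* Let $(V,q)$ be a (finite-dimensional, nondegenerate) quadratic space over a field $F$ (of arbitrary characteristic) and let $\tau\in O(V,q)$ with $(\tau-\mathrm{id})^2=0$. Let $W$ be a complement of $\mathrm{Res}(\tau)$ in $\mathrm{Fix}(\tau)$, i.e. $\mathrm{Fix}(\tau)=W\oplus\mathrm{Res}(\tau)$. Then there exists an orthogonal decomposition $V=W\perp V_1\perp\cdots\perp V_m$ into $\tau$-invariant regular subspaces, where $\tau|_W=\mathrm{id}$ and the integer $m$ and the subspaces $V_i$ can be described as follows: (1) If the Wall form $\omega_\tau$ is alternating, then $m=\frac12\dim_F\mathrm{Res}(\tau)$, and $\dim_FV_i=4$ and $\tau|_{V_i}$ is an interchange isometry for every $i$. More precisely, $(\mathrm{Res}(\tau),\omega_\tau)\simeq m\mathbb{H}_{-1}$, and if $(x_1,w_1,\dots,x_m,w_m)$ is a hyperbolic basis of $(\mathrm{Res}(\tau),\omega_\tau)$, then the subspaces $V_i$, $i=1,\dots,m$, can be chosen such that $\mathrm{Res}(\tau|_{V_i})=Fx_i+Fw_i$. (2) If $\omega_\tau$ is nonalternating, then $m=\dim_F\mathrm{Res}(\tau)$, and $\dim_FV_i=2$ and $\tau|_{V_i}$ is a reflection for every $i$. More precisely, if $(u_1,\dots,u_m)$ is an orthogonal basis of $(\mathrm{Res}(\tau),\omega_\tau)$, then the subspaces $V_i$, $i=1,\dots,m$, can be chosen such that $u_i\in V_i$ and $\tau|_{V_i}=\tau_{u_i}$.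
   Context: All vector spaces are finite-dimensional. For a quadratic form $q:V\to F$, the polar form is $\mathfrak{b}_q(u,v)=q(u+v)-q(u)-q(v)$. For a subspace $W$, $W^\perp=\{x\in V\mid \mathfrak{b}_q(x,y)=0\text{ for all }y\in W\}$; $W$ is regular if $W\cap W^\perp=\{0\}$. $(V,q)$ is called a quadratic space if $V$ is regular (so $\mathfrak{b}_q$ is nondegenerate). $O(V,q)$ is the group of isometries of $(V,q)$. For $\tau\in O(V,q)$: $\mathrm{Fix}(\tau)=\{x\in V\mid\tau(x)=x\}$ and $\mathrm{Res}(\tau)=\{\tau(x)-x\mid x\in V\}$. If $(\tau-\mathrm{id})^2=0$ then $\mathrm{Res}(\tau)\subseteq\mathrm{Fix}(\tau)$. The Wall form of $\tau$ is the (well-defined, nondegenerate) bilinear form $\omega_\tau:\mathrm{Res}(\tau)\times\mathrm{Res}(\tau)\to F$ given by $\omega_\tau(\tau(x)-x,\tau(y)-y)=\mathfrak{b}_q(\tau(x)-x,y)$ for $x,y\in V$. A bilinear form $\mathfrak b$ is alternating if $\mathfrak b(u,u)=0$ for all $u$, and nonalternating otherwise. A basis $(v_1,\dots,v_n)$ is orthogonal for $\mathfrak b$ if $\mathfrak b(v_i,v_j)=0$ for all $i\neq j$. $\mathbb{H}_{-1}$ is the $2$-dimensional bilinear form with basis $(u,v)$ satisfying $\mathfrak b(u,u)=\mathfrak b(v,v)=0$, $\mathfrak b(u,v)=1$, $\mathfrak b(v,u)=-1$; $m\mathbb{H}_{-1}$ is the orthogonal sum of $m$ copies. A hyperbolic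 basis of a form isometric to $m\mathbb{H}_{-1}$ is a basis $(x_1,w_1,\dots,x_m,w_m)$ with $\mathfrak b(x_i,x_i)=\mathfrak b(w_i,w_i)=0$, $\mathfrak b(x_i,w_i)=-\mathfrak b(w_i,x_i)=1$ and all other pairs of basis vectors orthogonal. An isometry $\rho$ of a $4$-dimensional quadratic space $(V',q')$ is an interchange isometry if $\mathrm{Fix}(\rho)$ is a $2$-dimensional totally isotropic subspace (i.e. $q'(v)=0$ for all $v\in\mathrm{Fix}(\rho)$). For $u$ with $q(u)\ne0$, the reflection along $u$ is $\tau_u(x)=x-\frac{\mathfrak{b}_q(u,x)}{q(u)}u$. In (2), $\tau|_{V_i}=\tau_{u_i}$ means $\tau|_{V_i}$ is the reflection of $(V_i,q|_{V_i})$ along $u_i$. *)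

theory Defs
  imports
    "HOL.Vector_Spaces"
    "HOL-Library.FuncSet"
    "HOL-Library.Product_Plus"
    "HOL-Library.Function_Algebras"
begin

text \<open>
  The ambient space is the whole type \<open>'b\<close>, with scalar multiplication \<open>scale\<close> over the field \<open>'a\<close>.
  Forms and maps are total functions. Every notion takes the subspace \<open>S\<close> it refers to as an
  argument, so that \<open>(S, q|\<^sub>S)\<close> and \<open>\<tau>|\<^sub>S\<close> need no separate representation.
\<close>

definition linear_on ::
    "('a \<Rightarrow> 'b::ab_group_add \<Rightarrow> 'b) \<Rightarrow> ('a \<Rightarrow> 'c::ab_group_add \<Rightarrow> 'c) \<Rightarrow> 'b set \<Rightarrow> ('b \<Rightarrow> 'c) \<Rightarrow> bool" where
  "linear_on s1 s2 S f \<longleftrightarrow>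
     (\<forall>x\<in>S. \<forall>y\<in>S. f (x + y) = f x + f y) \<and> (\<forall>c. \<forall>x\<in>S. f (s1 c x) = s2 c (f x))"

definition isometric ::
    "('a \<Rightarrow> 'b::ab_group_add \<Rightarrow> 'b) \<Rightarrow> 'b set \<Rightarrow> ('b \<Rightarrow> 'b \<Rightarrow> 'a) \<Rightarrow>
     ('a \<Rightarrow> 'c::ab_group_add \<Rightarrow> 'c) \<Rightarrow> 'c set \<Rightarrow> ('c \<Rightarrow> 'c \<Rightarrow> 'a) \<Rightarrow> bool" where
  "isometric s1 S1 b1 s2 S2 b2 \<longleftrightarrow>
     (\<exists>\<phi>. linear_on s1 s2 S1 \<phi> \<and> bij_betw \<phi> S1 S2 \<and> (\<forall>x\<in>S1. \<forall>y\<in>S1. b2 (\<phi> x) (\<phi> y) = b1 x y))"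

text \<open>
  \<open>\<bbbH>\<^sub>-\<^sub>1\<close> is modelled on \<open>'a \<times> 'a\<close> with \<open>u = (1, 0)\<close> and \<open>v = (0, 1)\<close>; the orthogonal sum of \<open>m\<close>
  copies consists of the families of pairs that vanish outside \<open>{1..m}\<close>.
\<close>

definition hyp_plane_form :: "'a::field \<times> 'a \<Rightarrow> 'a \<times> 'a \<Rightarrow> 'a" where
  "hyp_plane_form x y = fst x * snd y - snd x * fst y"

definition hyp_space :: "nat \<Rightarrow> (nat \<Rightarrow> 'a::field \<times> 'a) set" where
  "hyp_space m = {f. \<forall>i. i \<notin> {1..m} \<longrightarrow> f i = 0}"

definition hyp_scale :: "'a::field \<Rightarrow> (nat \<Rightarrow> 'a \<times> 'a) \<Rightarrow> (nat \<Rightarrow> 'a \<times> 'a)" where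
  "hyp_scale c f = (\<lambda>i. (c * fst (f i), c * snd (f i)))"

definition hyp_form :: "nat \<Rightarrow> (nat \<Rightarrow> 'a::field \<times> 'a) \<Rightarrow> (nat \<Rightarrow> 'a \<times> 'a) \<Rightarrow> 'a" where
  "hyp_form m f g = (\<Sum>i\<in>{1..m}. hyp_plane_form (f i) (g i))"

definition polar :: "('b::ab_group_add \<Rightarrow> 'a::field) \<Rightarrow> 'b \<Rightarrow> 'b \<Rightarrow> 'a" where
  "polar q u v = q (u + v) - q u - q v"

definition Fix :: "'b set \<Rightarrow> ('b \<Rightarrow> 'b) \<Rightarrow> 'b set" where
  "Fix S \<tau> = {x\<in>S. \<tau> x = x}"

definition Res :: "'b::ab_group_add set \<Rightarrow> ('b \<Rightarrow> 'b) \<Rightarrow> 'b set" where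
  "Res S \<tau> = {\<tau> x - x |x. x \<in> S}"

text \<open>Meaningful on \<open>Res S \<tau>\<close> only; \<open>wall_form_eq\<close> below shows that it is well defined there.\<close>

definition wall_form ::
    "'b::ab_group_add set \<Rightarrow> ('b \<Rightarrow> 'a::field) \<Rightarrow> ('b \<Rightarrow> 'b) \<Rightarrow> 'b \<Rightarrow> 'b \<Rightarrow> 'a" where
  "wall_form S q \<tau> u v =
     (THE c. \<exists>x\<in>S. \<exists>y\<in>S. u = \<tau> x - x \<and> v = \<tau> y - y \<and> c = polar q (\<tau> x - x) y)"

definition alternating_on :: "'b set \<Rightarrow> ('b \<Rightarrow> 'b \<Rightarrow> 'a::zero) \<Rightarrow> bool" where
  "alternating_on S b \<longleftrightarrow> (\<forall>u\<in>S. b u u = 0)"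

definition orth_complement :: "'b::ab_group_add set \<Rightarrow> ('b \<Rightarrow> 'a::field) \<Rightarrow> 'b set \<Rightarrow> 'b set" where
  "orth_complement S q W = {x\<in>S. \<forall>y\<in>W. polar q x y = 0}"

text \<open>The ambient space in which the orthogonal complement is formed does not matter here.\<close>

definition regular :: "('b::ab_group_add \<Rightarrow> 'a::field) \<Rightarrow> 'b set \<Rightarrow> bool" where
  "regular q W \<longleftrightarrow> W \<inter> orth_complement UNIV q W = {0}"

context vector_space
begin

definition bilinear_on :: "'b set \<Rightarrow> ('b \<Rightarrow> 'b \<Rightarrow> 'a) \<Rightarrow> bool" where
  "bilinear_on S b \<longleftrightarrow>
     (\<forall>y\<in>S. linear_on scale (*) S (\<lambda>x. b x y)) \<and> (\<forall>x\<in>S. linear_on scale (*) S (\<lambda>y. b x y))"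

definition quadratic_form_on :: "'b set \<Rightarrow> ('b \<Rightarrow> 'a) \<Rightarrow> bool" where
  "quadratic_form_on S q \<longleftrightarrow>
     (\<forall>c. \<forall>x\<in>S. q (scale c x) = c\<^sup>2 * q x) \<and> bilinear_on S (polar q)"

definition quadratic_space :: "'b set \<Rightarrow> ('b \<Rightarrow> 'a) \<Rightarrow> bool" where
  "quadratic_space S q \<longleftrightarrow> subspace S \<and> quadratic_form_on S q \<and> regular q S"

text \<open>The values of a member outside \<open>S\<close> are unconstrained.\<close>

definition orthogonal_group :: "'b set \<Rightarrow> ('b \<Rightarrow> 'a) \<Rightarrow> ('b \<Rightarrow> 'b) set" where
  "orthogonal_group S q =
     {\<tau>. linear_on scale scale S \<tau> \<and> bij_betw \<tau> S S \<and> (\<forall>x\<in>S. q (\<tau> x) = q x)}"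

definition is_complement :: "'b set \<Rightarrow> 'b set \<Rightarrow> 'b set \<Rightarrow> bool" where
  "is_complement S R W \<longleftrightarrow> subspace W \<and> W \<inter> R = {0} \<and> S = {w + r |w r. w \<in> W \<and> r \<in> R}"

definition is_basis :: "'b set \<Rightarrow> 'i set \<Rightarrow> ('i \<Rightarrow> 'b) \<Rightarrow> bool" where
  "is_basis S I v \<longleftrightarrow> inj_on v I \<and> independent (v ` I) \<and> span (v ` I) = S"

definition is_orthogonal_basis ::
    "'b set \<Rightarrow> ('b \<Rightarrow> 'b \<Rightarrow> 'a) \<Rightarrow> nat \<Rightarrow> (nat \<Rightarrow> 'b) \<Rightarrow> bool" where
  "is_orthogonal_basis S b n v \<longleftrightarrow>
     is_basis S {1..n} v \<and> (\<forall>i\<in>{1..n}. \<forall>j\<in>{1..n}. i \<noteq> j \<longrightarrow> b (v i) (v j) = 0)"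

text \<open>
  The family \<open>(x\<^sub>1, w\<^sub>1, \<dots>, x\<^sub>m, w\<^sub>m)\<close> is indexed by two disjoint copies of \<open>{1..m}\<close>.
\<close>

definition is_hyperbolic_basis ::
    "'b set \<Rightarrow> ('b \<Rightarrow> 'b \<Rightarrow> 'a) \<Rightarrow> nat \<Rightarrow> (nat \<Rightarrow> 'b) \<Rightarrow> (nat \<Rightarrow> 'b) \<Rightarrow> bool" where
  "is_hyperbolic_basis S b m x w \<longleftrightarrow>
     is_basis S ({1..m} <+> {1..m}) (case_sum x w) \<and>
     (\<forall>i\<in>{1..m}. b (x i) (x i) = 0 \<and> b (w i) (w i) = 0 \<and> b (x i) (w i) = 1 \<and> b (w i) (x i) = - 1) \<and>
     (\<forall>i\<in>{1..m}. \<forall>j\<in>{1..m}. i \<noteq> j \<longrightarrow>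
        b (x i) (x j) = 0 \<and> b (w i) (w j) = 0 \<and> b (x i) (w j) = 0 \<and> b (w i) (x j) = 0)"

definition orthogonal_decomposition ::
    "'b set \<Rightarrow> ('b \<Rightarrow> 'a) \<Rightarrow> 'i set \<Rightarrow> ('i \<Rightarrow> 'b set) \<Rightarrow> bool" where
  "orthogonal_decomposition S q I U \<longleftrightarrow>
     (\<forall>i\<in>I. subspace (U i) \<and> U i \<subseteq> S) \<and>
     (\<forall>x\<in>S. \<exists>!f. f \<in> Pi\<^sub>E I U \<and> x = (\<Sum>i\<in>I. f i)) \<and>
     (\<forall>i\<in>I. \<forall>j\<in>I. i \<noteq> j \<longrightarrow> (\<forall>x\<in>U i. \<forall>y\<in>U j. polar q x y = 0))"

text \<open>
  The decompositions \<open>W \<bottom> V\<^sub>1 \<bottom> \<dots> \<bottom> V\<^sub>m\<close> of the ambient space into \<open>\<tau>\<close>-invariant regular subspaces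
  such that \<open>\<tau>\<close> is the identity on \<open>W\<close>; the summand \<open>W\<close> gets the index 0.
\<close>

definition invariant_decomposition ::
    "('b \<Rightarrow> 'a) \<Rightarrow> ('b \<Rightarrow> 'b) \<Rightarrow> 'b set \<Rightarrow> nat \<Rightarrow> (nat \<Rightarrow> 'b set) \<Rightarrow> bool" where
  "invariant_decomposition q \<tau> W m V \<longleftrightarrow>
     (let U = (\<lambda>i. if i = 0 then W else V i) in
        orthogonal_decomposition UNIV q {0..m} U \<and>
        (\<forall>i\<in>{0..m}. regular q (U i) \<and> \<tau> ` U i \<subseteq> U i)) \<and>
     (\<forall>x\<in>W. \<tau> x = x)"

definition interchange_isometry :: "'b set \<Rightarrow> ('b \<Rightarrow> 'a) \<Rightarrow> ('b \<Rightarrow> 'b) \<Rightarrow> bool" where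
  "interchange_isometry S q \<rho> \<longleftrightarrow>
     quadratic_space S q \<and> dim S = 4 \<and> \<rho> \<in> orthogonal_group S q \<and>
     dim (Fix S \<rho>) = 2 \<and> (\<forall>v\<in>Fix S \<rho>. q v = 0)"

definition reflection :: "('b \<Rightarrow> 'a) \<Rightarrow> 'b \<Rightarrow> 'b \<Rightarrow> 'b" where
  "reflection q u x = x - scale (polar q u x / q u) u"

text \<open>\<open>q u \<noteq> 0\<close> is essential: since \<open>c / 0 = 0\<close>, \<open>reflection q u\<close> is the identity if \<open>q u = 0\<close>.\<close>

definition is_reflection_along :: "'b set \<Rightarrow> ('b \<Rightarrow> 'a) \<Rightarrow> 'b \<Rightarrow> ('b \<Rightarrow> 'b) \<Rightarrow> bool" where
  "is_reflection_along S q u \<rho> \<longleftrightarrow> u \<in> S \<and> q u \<noteq> 0 \<and> (\<forall>x\<in>S. \<rho> x = reflection q u x)"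

lemma wall_form_eq:
  assumes qs: "quadratic_space S q" and iso: "\<tau> \<in> orthogonal_group S q"
    and x: "x \<in> S" and y: "y \<in> S"
  shows "wall_form S q \<tau> (\<tau> x - x) (\<tau> y - y) = polar q (\<tau> x - x) y"
proof -
  have S: "subspace S" and bil: "bilinear_on S (polar q)"
    using qs by (auto simp: quadratic_space_def quadratic_form_on_def)
  have tS: "\<tau> z \<in> S" if "z \<in> S" for z
    using iso that by (auto simp: orthogonal_group_def dest: bij_betwE)
  have tadd: "\<tau> (a + b) = \<tau> a + \<tau> b" if "a \<in> S" "b \<in> S" for a b
    using iso that by (auto simp: orthogonal_group_def linear_on_def)
  have tq: "q (\<tau> a) = q a" if "a \<in> S" for a
    using iso that by (auto simp: orthogonal_group_def)
  have addl: "polar q (a + b) c = polar q a c + polar q b c" if "a \<in> S" "b \<in> S" "c \<in> S" for a b c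
    using bil that by (auto simp: bilinear_on_def linear_on_def)
  have addr: "polar q c (a + b) = polar q c a + polar q c b" if "a \<in> S" "b \<in> S" "c \<in> S" for a b c
    using bil that by (auto simp: bilinear_on_def linear_on_def)
  have tpol: "polar q (\<tau> a) (\<tau> b) = polar q a b" if "a \<in> S" "b \<in> S" for a b
    using that S by (simp add: polar_def tq tadd[symmetric] subspace_add)
  have orth: "polar q (\<tau> a - a) z = 0" if a: "a \<in> S" and z: "z \<in> S" and fz: "\<tau> z = z" for a z
  proof -
    have d: "\<tau> a - a \<in> S" using S tS a by (simp add: subspace_diff)
    have "polar q (\<tau> a) z = polar q a z" using tpol[OF a z] fz by simp
    moreover have "polar q (\<tau> a) z = polar q (\<tau> a - a) z + polar q a z"
      using addl[OF d a z] by simp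
    ultimately show ?thesis by simp
  qed
  have uniq: "polar q (\<tau> x' - x') y' = polar q (\<tau> x - x) y"
    if "x' \<in> S" "y' \<in> S" and ex: "\<tau> x - x = \<tau> x' - x'" and ey: "\<tau> y - y = \<tau> y' - y'" for x' y'
  proof -
    have d: "y - y' \<in> S" using S y that by (simp add: subspace_diff)
    have e: "\<tau> x - x \<in> S" using S tS x by (simp add: subspace_diff)
    have "\<tau> y = \<tau> (y - y') + \<tau> y'" using tadd[OF d \<open>y' \<in> S\<close>] by simp
    then have "\<tau> (y - y') = y - y'" using ey by (simp add: algebra_simps)
    then have "polar q (\<tau> x - x) (y - y') = 0" using orth[OF x d] by simp
    moreover have "polar q (\<tau> x - x) y = polar q (\<tau> x - x) (y - y') + polar q (\<tau> x - x) y'"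
      using addr[OF d \<open>y' \<in> S\<close> e] by simp
    ultimately show ?thesis using ex by simp
  qed
  show ?thesis
    unfolding wall_form_def
  proof (rule the_equality)
    show "\<exists>x'\<in>S. \<exists>y'\<in>S. \<tau> x - x = \<tau> x' - x' \<and> \<tau> y - y = \<tau> y' - y' \<and>
        polar q (\<tau> x - x) y = polar q (\<tau> x' - x') y'"
      using x y by blast
  next
    fix c assume "\<exists>x'\<in>S. \<exists>y'\<in>S. \<tau> x - x = \<tau> x' - x' \<and> \<tau> y - y = \<tau> y' - y' \<and>
        c = polar q (\<tau> x' - x') y'"
    then show "c = polar q (\<tau> x - x) y" using uniq by blast
  qed
qed

end

end

theory Submission
  imports Defs
begin

text \<open>
  Put \<open>\<sigma> = \<tau> - id\<close>. The Wall form is skew-symmetric and nondegenerate on \<open>Res(\<tau>)\<close>, with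
  \<open>q(u) = - \<omega>(u, u)\<close>. If it is alternating it has a hyperbolic basis; otherwise the characteristic is 2
  and, by Albert's theorem, it has an orthogonal basis. Both kinds of basis \<open>(e\<^sub>i)\<close> come with an
  involution \<open>p\<close> of the index set such that \<open>\<omega>(e\<^sub>i, e\<^sub>j)\<close> vanishes exactly when \<open>j \<noteq> p(i)\<close>. Choose \<open>y\<^sub>i\<close>
  with \<open>\<sigma>(y\<^sub>i) = e\<^sub>i\<close>, so that \<open>\<bb>(e\<^sub>i, y\<^sub>j) = \<omega>(e\<^sub>i, e\<^sub>j)\<close>. Correcting the \<open>y\<^sub>i\<close> by elements of the regular space \<open>W\<close>
  makes them orthogonal to \<open>W\<close>, and correcting them further by elements of \<open>Res(\<tau>)\<close> makes them
  pairwise orthogonal. The summands \<open>V\<^sub>j\<close> are then spanned by the \<open>e\<^sub>i\<close> and \<open>y\<^sub>i\<close> with \<open>i\<close> in one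
  orbit of \<open>p\<close>.
\<close>

section \<open>Families of vectors and bilinear forms\<close>

definition nondegenerate_on :: "'b::zero set \<Rightarrow> ('b \<Rightarrow> 'b \<Rightarrow> 'a::zero) \<Rightarrow> bool" where
  "nondegenerate_on S B \<longleftrightarrow> (\<forall>x\<in>S. (\<forall>y\<in>S. B x y = 0) \<longrightarrow> x = 0)"

definition skew_on :: "'b set \<Rightarrow> ('b \<Rightarrow> 'b \<Rightarrow> 'a::uminus) \<Rightarrow> bool" where
  "skew_on S B \<longleftrightarrow> (\<forall>x\<in>S. \<forall>y\<in>S. B x y = - B y x)"

definition perp_on :: "'b set \<Rightarrow> ('b \<Rightarrow> 'b \<Rightarrow> 'a::zero) \<Rightarrow> 'b set \<Rightarrow> 'b set" where
  "perp_on S B P = {z \<in> S. \<forall>p\<in>P. B z p = 0}"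

context vector_space
begin

section \<open>Coordinates and linear independence of indexed families\<close>

lemma span_image_finite:
  assumes "finite I"
  shows "span (e ` I) = range (\<lambda>c. \<Sum>i\<in>I. c i *s e i)"
  using assms
proof (induction I rule: finite_induct)
  case empty
  then show ?case by auto
next
  case (insert i I)
  have "x \<in> span (e ` insert i I) \<longleftrightarrow> (\<exists>c. x = (\<Sum>j\<in>insert i I. c j *s e j))" for x
  proof
    assume "x \<in> span (e ` insert i I)"
    then obtain k where "x - k *s e i \<in> span (e ` I)"
      by (auto simp: span_breakdown_eq)
    then obtain c where c: "x - k *s e i = (\<Sum>j\<in>I. c j *s e j)"
      using insert.IH by auto
    have "(\<Sum>j\<in>I. (c(i := k)) j *s e j) = (\<Sum>j\<in>I. c j *s e j)"
      using insert.hyps by (intro sum.cong) auto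
    then have "x = (\<Sum>j\<in>insert i I. (c(i := k)) j *s e j)"
      using c insert.hyps by (simp add: algebra_simps)
    then show "\<exists>c. x = (\<Sum>j\<in>insert i I. c j *s e j)" by blast
  next
    assume "\<exists>c. x = (\<Sum>j\<in>insert i I. c j *s e j)"
    then show "x \<in> span (e ` insert i I)"
      by (blast intro: span_sum span_scale span_base)
  qed
  then show ?case by blast
qed

text \<open>A coincidence \<open>e i = e j\<close> with \<open>i \<noteq> j\<close> is itself a
  nontrivial relation, with coefficients 1 and -1. The coefficient condition therefore gives
  injectivity as well as independence of the image set.\<close>

lemma independent_familyI:
  assumes fin: "finite I"
    and zero: "\<And>c. (\<Sum>i\<in>I. c i *s e i) = 0 \<Longrightarrow> \<forall>i\<in>I. c i = 0"
  shows "inj_on e I" and "independent (e ` I)"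
proof -
  show inj: "inj_on e I"
  proof (rule inj_onI, rule ccontr)
    fix i j assume ij: "i \<in> I" "j \<in> I" "e i = e j" "i \<noteq> j"
    have "(\<Sum>k\<in>I. ((if k = i then 1 else 0) - (if k = j then 1 else 0)) *s e k)
        = (\<Sum>k\<in>I. (if k = i then e k else 0)) - (\<Sum>k\<in>I. (if k = j then e k else 0))"
      unfolding sum_subtractf[symmetric]
      by (intro sum.cong) (auto simp: scale_left_diff_distrib)
    also have "\<dots> = 0" using fin ij by simp
    finally show False using zero[of "\<lambda>k. (if k = i then 1 else 0) - (if k = j then 1 else 0)"] ij
      by auto
  qed
  show "independent (e ` I)"
  proof
    assume "dependent (e ` I)"
    then obtain u where u: "\<exists>v\<in>e ` I. u v \<noteq> 0" "(\<Sum>v\<in>e ` I. u v *s v) = 0"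
      using fin by (auto simp: dependent_finite)
    then have "(\<Sum>i\<in>I. u (e i) *s e i) = 0"
      using inj by (simp add: sum.reindex)
    then show False using zero[of "\<lambda>i. u (e i)"] u(1) by blast
  qed
qed

text \<open>\<open>independent\<close> speaks of a set of vectors; injectivity lets coefficients
  indexed by \<open>I\<close> be carried to that set through \<open>the_inv_into\<close>.\<close>

lemma independent_familyD:
  assumes "finite I" "inj_on e I" "independent (e ` I)" "(\<Sum>i\<in>I. c i *s e i) = 0" "i \<in> I"
  shows "c i = 0"
proof -
  have "(\<Sum>v\<in>e ` I. c (the_inv_into I e v) *s v) = 0"
    using assms by (simp add: sum.reindex the_inv_into_f_f)
  then have "c (the_inv_into I e (e i)) = 0"
    using independentD[OF assms(3) finite_imageI[OF assms(1)] subset_refl,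
        of "\<lambda>v. c (the_inv_into I e v)"] assms by blast
  then show ?thesis using assms by (simp add: the_inv_into_f_f)
qed

lemma dim_span_family:
  assumes "inj_on e I" "independent (e ` I)"
  shows "dim (span (e ` I)) = card I"
  unfolding dim_span_eq_card_independent[OF assms(2)] using assms(1) by (rule card_image)

lemma dim_is_basis: "is_basis S I e \<Longrightarrow> dim S = card I"
  using dim_span_family by (auto simp: is_basis_def)

section \<open>Linear and bilinear maps on finite sums\<close>

lemma linear_on_sum:
  assumes "linear_on scale (*) S f" "subspace S" "\<And>i. i \<in> I \<Longrightarrow> e i \<in> S"
  shows "f (\<Sum>i\<in>I. c i *s e i) = (\<Sum>i\<in>I. c i * f (e i))"
proof -
  have f0: "f 0 = 0"
    using assms(1,2) unfolding linear_on_def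
    by (metis scale_zero_left mult_zero_left subspace_0)
  from assms(3) show ?thesis
  proof (induction I rule: infinite_finite_induct)
    case (insert i I)
    have "(\<Sum>i\<in>I. c i *s e i) \<in> S"
      using insert.prems assms(2) by (intro subspace_sum subspace_scale) auto
    then show ?case
      using insert assms(1,2) by (simp add: linear_on_def subspace_scale)
  qed (use f0 in auto)
qed

lemma bilinear_on_sum_left:
  assumes "bilinear_on S B" "subspace S" "\<And>i. i \<in> I \<Longrightarrow> e i \<in> S" "y \<in> S"
  shows "B (\<Sum>i\<in>I. c i *s e i) y = (\<Sum>i\<in>I. c i * B (e i) y)"
  using assms linear_on_sum[of S "\<lambda>x. B x y" I e c] by (simp add: bilinear_on_def)

lemma bilinear_on_sum_right:
  assumes "bilinear_on S B" "subspace S" "\<And>i. i \<in> I \<Longrightarrow> e i \<in> S" "x \<in> S"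
  shows "B x (\<Sum>i\<in>I. c i *s e i) = (\<Sum>i\<in>I. c i * B x (e i))"
  using assms linear_on_sum[of S "B x" I e c] by (simp add: bilinear_on_def)

lemma bilinear_on_simps:
  assumes "bilinear_on S B" "subspace S"
  shows "\<And>x y z. x \<in> S \<Longrightarrow> y \<in> S \<Longrightarrow> z \<in> S \<Longrightarrow> B (x + y) z = B x z + B y z"
    and "\<And>x y z. x \<in> S \<Longrightarrow> y \<in> S \<Longrightarrow> z \<in> S \<Longrightarrow> B z (x + y) = B z x + B z y"
    and "\<And>x y c. x \<in> S \<Longrightarrow> y \<in> S \<Longrightarrow> B (c *s x) y = c * B x y"
    and "\<And>x y c. x \<in> S \<Longrightarrow> y \<in> S \<Longrightarrow> B x (c *s y) = c * B x y"
    and "\<And>x y z. x \<in> S \<Longrightarrow> y \<in> S \<Longrightarrow> z \<in> S \<Longrightarrow> B (x - y) z = B x z - B y z"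
    and "\<And>x y z. x \<in> S \<Longrightarrow> y \<in> S \<Longrightarrow> z \<in> S \<Longrightarrow> B z (x - y) = B z x - B z y"
    and "\<And>x. x \<in> S \<Longrightarrow> B 0 x = 0"
    and "\<And>x. x \<in> S \<Longrightarrow> B x 0 = 0"
proof -
  show add: "B (x + y) z = B x z + B y z" "B z (x + y) = B z x + B z y"
    if "x \<in> S" "y \<in> S" "z \<in> S" for x y z
    using assms that by (auto simp: bilinear_on_def linear_on_def)
  show scale: "B (c *s x) y = c * B x y" "B x (c *s y) = c * B x y" if "x \<in> S" "y \<in> S" for c x y
    using assms that by (auto simp: bilinear_on_def linear_on_def)
  show "B (x - y) z = B x z - B y z" "B z (x - y) = B z x - B z y"
    if "x \<in> S" "y \<in> S" "z \<in> S" for x y z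
    using add[of "x - y" y z] that assms(2) by (simp_all add: subspace_diff)
  show "B 0 x = 0" "B x 0 = 0" if "x \<in> S" for x
    using scale[of 0 x 0] scale[of x 0 0] that assms(2) by (simp_all add: subspace_0)
qed

text \<open>Pairing a relation with \<open>f j\<close> leaves only its \<open>j\<close>-th
  coefficient, times a nonzero scalar. With \<open>f\<close> a reordering of \<open>e\<close> this
  serves hyperbolic and orthogonal bases alike.\<close>

lemma dual_family_is_basis:
  assumes bil: "bilinear_on S B" and sub: "subspace S" and fin: "finite I"
    and e: "\<And>i. i \<in> I \<Longrightarrow> e i \<in> S" and f: "\<And>i. i \<in> I \<Longrightarrow> f i \<in> S"
    and orth: "\<And>i j. i \<in> I \<Longrightarrow> j \<in> I \<Longrightarrow> i \<noteq> j \<Longrightarrow> B (e i) (f j) = 0"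
    and nz: "\<And>i. i \<in> I \<Longrightarrow> B (e i) (f i) \<noteq> 0"
    and span: "span (e ` I) = S"
  shows "is_basis S I e"
proof -
  have "\<forall>i\<in>I. c i = 0" if z: "(\<Sum>i\<in>I. c i *s e i) = 0" for c
  proof
    fix j assume j: "j \<in> I"
    have "0 = B (\<Sum>i\<in>I. c i *s e i) (f j)"
      using z bilinear_on_simps(7)[OF bil sub] f j by simp
    also have "\<dots> = (\<Sum>i\<in>I. c i * B (e i) (f j))"
      using bilinear_on_sum_left[OF bil sub] e f j by blast
    also have "\<dots> = (\<Sum>i\<in>I. if i = j then c j * B (e j) (f j) else 0)"
      using orth j by (intro sum.cong) auto
    also have "\<dots> = c j * B (e j) (f j)" using fin j by simp
    finally show "c j = 0" using nz j by simp
  qed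
  then show ?thesis
    using independent_familyI[OF fin] span unfolding is_basis_def by blast
qed

lemma bilinear_on_subset: "bilinear_on S B \<Longrightarrow> T \<subseteq> S \<Longrightarrow> bilinear_on T B"
  by (auto simp: bilinear_on_def linear_on_def subset_iff)

end

text \<open>Functionals on a subspace carrying a nondegenerate form are represented by vectors: the
  linear map \<open>x \<mapsto> \<Sum>\<^sub>e B(x, e) e\<close>, the sum taken over a basis, is injective, hence onto.\<close>

lemma (in finite_dimensional_vector_space) linear_on_represented:
  assumes bil: "bilinear_on UNIV B" and sub: "subspace S"
    and nondeg: "nondegenerate_on S B" and f: "linear_on scale (*) S f"
  shows "\<exists>s\<in>S. \<forall>y\<in>S. B s y = f y"
proof -
  obtain E where E: "E \<subseteq> S" "independent E" "S \<subseteq> span E"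
    by (rule basis_exists)
  have finE: "finite E" using E(2) by (rule finiteI_independent)
  note bs = bilinear_on_simps(1,2,5,6)[OF bil subspace_UNIV UNIV_I UNIV_I UNIV_I]
    bilinear_on_simps(3,4)[OF bil subspace_UNIV UNIV_I UNIV_I]
    bilinear_on_simps(7,8)[OF bil subspace_UNIV UNIV_I]
  define T where "T x = (\<Sum>e\<in>E. B x e *s e)" for x
  \<comment> \<open>Provides the theory of linear maps with finite-dimensional source, in particular
    that an injective map preserves dimension.\<close>
  interpret T: finite_dimensional_vector_space_pair_1 scale Basis scale
    by unfold_locales
  have lin: "Vector_Spaces.linear scale scale T"
    by (intro Vector_Spaces.linear.intro module_hom.intro module_hom_axioms.intro)
      (unfold_locales, auto simp: T_def bs scale_left_distrib sum.distrib scale_sum_right)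
  have TE: "T x \<in> S" for x
    unfolding T_def using E(1) sub by (intro subspace_sum subspace_scale) auto
  have expand: "y = (\<Sum>e\<in>E. c e *s e) \<Longrightarrow> B x y = (\<Sum>e\<in>E. c e * B x e)" for x y c
    using bilinear_on_sum_right[OF bil subspace_UNIV, of E "\<lambda>e. e" x c] by simp
  have coords: "\<exists>c. y = (\<Sum>e\<in>E. c e *s e)" if "y \<in> S" for y
    using that E(3) span_finite[OF finE] by auto
  have coeff: "a e = b e" if "(\<Sum>e\<in>E. a e *s e) = (\<Sum>e\<in>E. b e *s e)" "e \<in> E" for a b e
  proof -
    have "(\<Sum>e\<in>E. (a e - b e) *s e) = 0"
      using that(1) by (simp add: scale_left_diff_distrib sum_subtractf)
    from independentD[OF E(2) finE subset_refl this that(2)] show ?thesis by simp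
  qed
  have inj: "inj_on T (span S)"
  proof (rule inj_onI)
    fix x y assume xy: "x \<in> span S" "y \<in> span S" "T x = T y"
    have "B (x - y) e = 0" if "e \<in> E" for e
      using coeff[OF xy(3)[unfolded T_def] that] by (simp add: bs)
    then have "B (x - y) z = 0" if "z \<in> S" for z
      using coords[OF that] expand[of z _ "x - y"] by force
    moreover have "x - y \<in> S" using xy sub by (metis span_eq_iff subspace_diff)
    ultimately show "x = y" using nondeg unfolding nondegenerate_on_def by force
  qed
  have "T ` S = S"
  proof (rule subspace_dim_equal)
    show "subspace (T ` S)"
      using lin sub by (meson Vector_Spaces.linear.axioms(3) module_hom.subspace_image)
    show "dim S \<le> dim (T ` S)" using T.dim_image_eq[OF lin inj] by simp
  qed (use TE sub in auto)
  \<comment> \<open>A preimage under \<open>T\<close> of the vector with coordinates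
    \<open>f e\<close> represents \<open>f\<close> on the basis \<open>E\<close>, by comparison of
    coefficients.\<close>
  moreover have "(\<Sum>e\<in>E. f e *s e) \<in> S"
    using E(1) sub by (intro subspace_sum subspace_scale) auto
  ultimately obtain s where s: "s \<in> S" "T s = (\<Sum>e\<in>E. f e *s e)"
    by (metis imageE)
  have se: "B s e = f e" if "e \<in> E" for e
    using coeff[OF s(2)[unfolded T_def] that] .
  have "B s y = f y" if y: "y \<in> S" for y
  proof -
    obtain c where c: "y = (\<Sum>e\<in>E. c e *s e)" using coords[OF y] by blast
    show ?thesis
      using expand[OF c, of s] linear_on_sum[OF f sub, of E "\<lambda>e. e" c] E(1) c se
      by (simp add: subset_iff)
  qed
  then show ?thesis using s(1) by blast
qed

section \<open>Hyperbolic and orthogonal bases\<close>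

context finite_dimensional_vector_space
begin

section \<open>Splitting off a subspace and its orthogonal complement\<close>

lemma perp_on_span:
  assumes bil: "bilinear_on S B" and sub: "subspace S" and P: "P \<subseteq> S"
    and z: "z \<in> perp_on S B P" and p: "p \<in> span P"
  shows "B z p = 0"
proof -
  note bs = bilinear_on_simps[OF bil sub]
  have zS: "z \<in> S" and zP: "\<And>p. p \<in> P \<Longrightarrow> B z p = 0" using z by (auto simp: perp_on_def)
  \<comment> \<open>Membership in \<open>S\<close> is carried through the induction because
    \<open>B\<close> is known to be bilinear only there.\<close>
  have "p \<in> S \<and> B z p = 0"
    using p
  proof (induction rule: span_induct_alt)
    case base
    then show ?case using bs(8)[OF zS] sub by (simp add: subspace_0)
  next
    case (step c x y)
    then have "x \<in> S" "c *s x \<in> S" using P sub by (auto intro: subspace_scale)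
    with step zS zP show ?case by (simp add: bs(2,4) subspace_add[OF sub])
  qed
  then show ?thesis by simp
qed

text \<open>The common induction step for both kinds of bases. Since \<open>S\<close> is the sum of
  \<open>span P\<close> and the complement, a vector of the complement that is orthogonal to the
  complement is orthogonal to all of \<open>S\<close>; so nondegeneracy is inherited.\<close>

lemma perp_on_split:
  assumes bil: "bilinear_on S B" and sub: "subspace S" and skew: "skew_on S B"
    and nondeg: "nondegenerate_on S B" and P: "P \<subseteq> S" "\<not> P \<subseteq> {0}"
    and split: "\<forall>z\<in>S. \<exists>p\<in>span P. z - p \<in> perp_on S B P"
  shows "bilinear_on (perp_on S B P) B" "subspace (perp_on S B P)" "skew_on (perp_on S B P) B"
    and "nondegenerate_on (perp_on S B P) B" "dim (perp_on S B P) < dim S"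
    and "span Q = perp_on S B P \<Longrightarrow> span (P \<union> Q) = S"
proof -
  let ?T = "perp_on S B P"
  note bs = bilinear_on_simps[OF bil sub]
  have TS: "?T \<subseteq> S" by (auto simp: perp_on_def)
  show "bilinear_on ?T B" by (rule bilinear_on_subset[OF bil TS])
  show subT: "subspace ?T"
    using sub P(1) by (auto simp: perp_on_def subspace_def bs subset_iff)
  show "skew_on ?T B" using skew TS by (auto simp: skew_on_def)
  have zero: "x = 0" if x: "x \<in> ?T" and xT: "\<And>y. y \<in> ?T \<Longrightarrow> B x y = 0" for x
  proof -
    have "B x z = 0" if z: "z \<in> S" for z
    proof -
      obtain p where p: "p \<in> span P" "z - p \<in> ?T" using split z by blast
      have pS: "p \<in> S" using p(1) span_minimal[OF P(1) sub] by blast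
      have "B x z = B x p + B x (z - p)"
        using bs(2)[of p "z - p" x] pS z x TS sub by (auto simp: subspace_diff)
      then show ?thesis using perp_on_span[OF bil sub P(1) x p(1)] xT[OF p(2)] by simp
    qed
    then show ?thesis using nondeg x TS by (auto simp: nondegenerate_on_def)
  qed
  then show "nondegenerate_on ?T B" by (auto simp: nondegenerate_on_def)
  obtain p where p: "p \<in> P" "p \<noteq> 0" using P(2) by auto
  \<comment> \<open>Inside the complement, \<open>p\<close> would by skewness be orthogonal to the
    whole complement, hence zero. This makes the dimension drop.\<close>
  have "p \<notin> ?T"
  proof
    assume pT: "p \<in> ?T"
    have "B p y = 0" if y: "y \<in> ?T" for y
    proof -
      have "B y p = 0" using y p by (auto simp: perp_on_def)
      then show ?thesis using skew p P y TS unfolding skew_on_def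
        by (metis neg_equal_0_iff_equal subsetD)
    qed
    then show False using zero[OF pT] p by blast
  qed
  then have "span ?T \<subset> span S"
    using TS p P sub subT by (metis span_eq_iff psubsetI subsetD)
  then show "dim ?T < dim S" by (rule dim_psubset)
  show "span (P \<union> Q) = S" if Q: "span Q = ?T"
  proof (rule span_subspace)
    have "Q \<subseteq> S" using Q TS span_superset by blast
    then show "P \<union> Q \<subseteq> S" using P by blast
    show "S \<subseteq> span (P \<union> Q)"
    proof
      fix z assume "z \<in> S"
      then obtain p where p: "p \<in> span P" "z - p \<in> span Q" using split Q by blast
      then have "p + (z - p) \<in> span (P \<union> Q)"
        by (meson span_add span_mono sup_ge1 sup_ge2 subsetD)
      then show "z \<in> span (P \<union> Q)" by simp
    qed
  qed (rule sub)
qed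

text \<open>Swapping the two halves of the second family puts each vector opposite its partner, so
  the Gram matrix becomes diagonal, as \<open>dual_family_is_basis\<close> requires.\<close>

lemma hyperbolic_gram:
  assumes diag: "\<forall>i\<in>{1..m}. B (x i) (x i) = 0 \<and> B (w i) (w i) = 0 \<and>
      B (x i) (w i) = 1 \<and> B (w i) (x i) = - 1"
    and off: "\<forall>i\<in>{1..m}. \<forall>j\<in>{1..m}. i \<noteq> j \<longrightarrow>
      B (x i) (x j) = 0 \<and> B (w i) (w j) = 0 \<and> B (x i) (w j) = 0 \<and> B (w i) (x j) = 0"
    and ij: "i \<in> {1..m} <+> {1..m}" "j \<in> {1..m} <+> {1..m}"
  shows "B (case_sum x w i) (case_sum w x j) = (if i \<noteq> j then 0 else case_sum (\<lambda>_. 1) (\<lambda>_. - 1) i)"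
proof -
  have ?thesis if "i = f k" "j = g l" "k \<in> {1..m}" "l \<in> {1..m}" "f \<in> {Inl, Inr}" "g \<in> {Inl, Inr}"
    for f g k l
    using that diag[rule_format, OF that(3)] off[rule_format, OF that(3,4)]
    by (cases "k = l") auto
  with ij show ?thesis by (elim PlusE) blast+
qed

text \<open>Induction on the dimension: nondegeneracy supplies a pair with \<open>B a b = 1\<close>,
  whose plane splits off, and the form stays alternating on the complement.\<close>

lemma hyperbolic_basis_exists:
  assumes "bilinear_on S B" "subspace S" "alternating_on S B" "nondegenerate_on S B"
  shows "\<exists>m x w. is_hyperbolic_basis S B m x w"
  using assms
proof (induction "dim S" arbitrary: S rule: less_induct)
  case less
  note bil = less.prems(1) and sub = less.prems(2)
  note bs = bilinear_on_simps[OF bil sub]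
  have alt: "B u u = 0" if "u \<in> S" for u
    using less.prems(3) that by (auto simp: alternating_on_def)
  have skew: "B u v = - B v u" if "u \<in> S" "v \<in> S" for u v
  proof -
    have uv: "u + v \<in> S" using that sub by (simp add: subspace_add)
    have "B u v + B v u = B (u + v) (u + v)"
      using that uv bs(1)[of u v "u + v"] bs(2)[of u v u] bs(2)[of u v v]
      by (simp add: alt[OF that(1)] alt[OF that(2)])
    then show ?thesis using alt[OF uv] by (simp add: eq_neg_iff_add_eq_0)
  qed
  show ?case
  proof (cases "S = {0}")
    case True
    then have "is_hyperbolic_basis S B 0 (\<lambda>_. 0) (\<lambda>_. 0)"
      by (simp add: is_hyperbolic_basis_def is_basis_def Plus_def independent_empty)
    then show ?thesis by blast
  next
    case False
    then obtain a where a: "a \<in> S" "a \<noteq> 0" using subspace_0[OF sub] by blast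
    then obtain b' where b': "b' \<in> S" "B a b' \<noteq> 0"
      using less.prems(4) by (auto simp: nondegenerate_on_def)
    define b where "b = inverse (B a b') *s b'"
    have b: "b \<in> S" and ab: "B a b = 1" using a b' sub by (auto simp: b_def bs subspace_scale)
    have ba: "B b a = - 1" using skew[OF b a(1)] ab by simp
    let ?T = "perp_on S B {a, b}"
    have split: "\<forall>z\<in>S. \<exists>p\<in>span {a, b}. z - p \<in> ?T"
    proof (intro ballI bexI)
      fix z assume z: "z \<in> S"
      \<comment> \<open>The projection of \<open>z\<close> to the plane; the minus sign comes from
        \<open>B b a = - 1\<close>.\<close>
      let ?p = "B z b *s a - B z a *s b"
      show "?p \<in> span {a, b}" by (intro span_diff span_scale span_base) auto
      show "z - ?p \<in> ?T"
        using z a b sub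
        by (simp add: perp_on_def subspace_diff subspace_scale bs ab ba alt)
    qed
    have skew': "skew_on S B" using skew unfolding skew_on_def by blast
    have ne: "\<not> {a, b} \<subseteq> {0}" "{a, b} \<subseteq> S" using a b by auto
    note T = perp_on_split[OF bil sub skew' less.prems(4) ne(2,1) split]
    have altT: "alternating_on ?T B"
      using alt unfolding alternating_on_def perp_on_def by blast
    from less.hyps[OF T(5,1,2) altT T(4)]
    obtain m x w where IH: "is_hyperbolic_basis ?T B m x w" by (elim exE)
    let ?I = "{1..m} <+> {1..m}" and ?J = "{1..Suc m} <+> {1..Suc m}"
    \<comment> \<open>Indices run from 1 to \<open>m\<close>, so the new pair is appended at
      \<open>Suc m\<close>.\<close>
    let ?x = "x(Suc m := a)" and ?w = "w(Suc m := b)"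
    have im: "case_sum f g ` ({1..k} <+> {1..k}) = f ` {1..k} \<union> g ` {1..k}"
      for f g :: "nat \<Rightarrow> 'b" and k
      by (auto simp: image_Un Plus_def image_image)
    have spT: "span (case_sum x w ` ?I) = ?T"
      using IH by (simp add: is_hyperbolic_basis_def is_basis_def)
    have img: "case_sum ?x ?w ` ?J = {a, b} \<union> case_sum x w ` ?I"
      unfolding im by (auto simp: atLeastAtMostSuc_conv)
    have sp: "span (case_sum ?x ?w ` ?J) = S" unfolding img by (rule T(6)[OF spT])
    have xT: "x i \<in> ?T" "w i \<in> ?T" if "i \<in> {1..m}" for i
      using that span_superset[of "case_sum x w ` ?I", unfolded spT, unfolded im] by blast+
    have xS: "x i \<in> S" "w i \<in> S" "B (x i) a = 0" "B (x i) b = 0" "B (w i) a = 0" "B (w i) b = 0"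
      "B a (x i) = 0" "B b (x i) = 0" "B a (w i) = 0" "B b (w i) = 0"
      if "i \<in> {1..m}" for i
    proof -
      show *: "x i \<in> S" "w i \<in> S" "B (x i) a = 0" "B (x i) b = 0" "B (w i) a = 0" "B (w i) b = 0"
        using xT[OF that] by (auto simp: perp_on_def)
      show "B a (x i) = 0" "B b (x i) = 0" "B a (w i) = 0" "B b (w i) = 0"
        using * skew[OF a(1) *(1)] skew[OF b *(1)] skew[OF a(1) *(2)] skew[OF b *(2)] by simp_all
    qed
    have diag: "\<forall>i\<in>{1..Suc m}. B (?x i) (?x i) = 0 \<and> B (?w i) (?w i) = 0 \<and>
        B (?x i) (?w i) = 1 \<and> B (?w i) (?x i) = - 1"
      using IH a b ab ba alt by (auto simp: is_hyperbolic_basis_def le_Suc_eq)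
    have off: "\<forall>i\<in>{1..Suc m}. \<forall>j\<in>{1..Suc m}. i \<noteq> j \<longrightarrow>
        B (?x i) (?x j) = 0 \<and> B (?w i) (?w j) = 0 \<and> B (?x i) (?w j) = 0 \<and> B (?w i) (?x j) = 0"
    proof (intro ballI impI)
      fix i j assume ij: "i \<in> {1..Suc m}" "j \<in> {1..Suc m}" "i \<noteq> j"
      consider "i \<in> {1..m}" "j \<in> {1..m}" | "i \<in> {1..m}" "j = Suc m" | "i = Suc m" "j \<in> {1..m}"
        using ij by force
      then show "B (?x i) (?x j) = 0 \<and> B (?w i) (?w j) = 0 \<and> B (?x i) (?w j) = 0 \<and> B (?w i) (?x j) = 0"
      proof cases
        case 1
        then show ?thesis using IH ij(3) by (auto simp: is_hyperbolic_basis_def)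
      next
        case 2
        then show ?thesis using xS[of i] by auto
      next
        case 3
        then show ?thesis using xS[of j] by auto
      qed
    qed
    have "is_basis S ?J (case_sum ?x ?w)"
    proof (rule dual_family_is_basis[OF bil sub, where f = "case_sum ?w ?x"])
      have mem: "?x i \<in> S" "?w i \<in> S" if "i \<in> {1..Suc m}" for i
        using that xS a b by (auto simp: le_Suc_eq)
      show "case_sum ?x ?w i \<in> S" "case_sum ?w ?x i \<in> S" if "i \<in> ?J" for i
        using that mem by (auto simp del: fun_upd_apply)
      note gram = hyperbolic_gram[of "Suc m" B ?x ?w, OF diag off]
      show "B (case_sum ?x ?w i) (case_sum ?w ?x j) = 0" if "i \<in> ?J" "j \<in> ?J" "i \<noteq> j" for i j
        using gram that by simp
      show "B (case_sum ?x ?w i) (case_sum ?w ?x i) \<noteq> 0" if "i \<in> ?J" for i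
        using gram[OF that that] by (auto split: sum.splits)
    qed (use sp in auto)
    then have "is_hyperbolic_basis S B (Suc m) ?x ?w"
      using diag off unfolding is_hyperbolic_basis_def by blast
    then show ?thesis by blast
  qed
qed

text \<open>Albert's argument: if \<open>u\<^sup>\<bottom>\<close> is alternating and contains \<open>x\<close>, \<open>y\<close> with \<open>B(x, y) = 1\<close>, then
  \<open>u + x\<close> is anisotropic and orthogonal to the anisotropic vector \<open>u + B(u, u) y\<close>.\<close>

lemma nonalternating_perp:
  assumes bil: "bilinear_on S B" and sub: "subspace S" and nondeg: "nondegenerate_on S B"
    and sym: "\<And>x y. x \<in> S \<Longrightarrow> y \<in> S \<Longrightarrow> B x y = B y x" and two: "(1::'a) + 1 = 0"
    and nalt: "\<not> alternating_on S B"
    and perp_nondeg: "\<And>u. u \<in> S \<Longrightarrow> B u u \<noteq> 0 \<Longrightarrow> nondegenerate_on (perp_on S B {u}) B"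
  shows "\<exists>u\<in>S. B u u \<noteq> 0 \<and> (perp_on S B {u} = {0} \<or> \<not> alternating_on (perp_on S B {u}) B)"
proof -
  note bs = bilinear_on_simps[OF bil sub]
  have dbl: "a + a = 0" for a :: 'a
    using two by (metis mult_2 one_add_one mult_zero_left)
  obtain u where u: "u \<in> S" "B u u \<noteq> 0" using nalt by (auto simp: alternating_on_def)
  let ?T = "perp_on S B {u}"
  have mem: "z \<in> S" "B z u = 0" "B u z = 0" if "z \<in> ?T" for z
    using that sym[OF u(1), of z] by (auto simp: perp_on_def)
  show ?thesis
  proof (cases "?T = {0} \<or> \<not> alternating_on ?T B")
    case True
    then show ?thesis using u by blast
  next
    case False
    have alt: "B z z = 0" if "z \<in> ?T" for z
      using that False by (auto simp: alternating_on_def)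
    have "0 \<in> ?T" using bs(7)[OF u(1)] sub by (auto simp: perp_on_def subspace_0)
    then obtain x where x: "x \<in> ?T" "x \<noteq> 0" using False by auto
    then obtain y where y: "y \<in> ?T" "B x y \<noteq> 0"
      using perp_nondeg[OF u] unfolding nondegenerate_on_def by blast
    \<comment> \<open>Instead of normalising \<open>B x y\<close> to 1, the scalar \<open>c\<close>
      absorbs it. Then \<open>?v\<close> and \<open>?u\<close> pair to \<open>B u u + B u u\<close>,
      which is zero in characteristic 2.\<close>
    define c where "c = B u u / B x y"
    have cxy: "c * B x y = B u u" "c * B y x = B u u"
      using y sym[of x y] mem(1)[OF x(1)] mem(1)[OF y(1)] by (auto simp: c_def)
    let ?u = "u + x" and ?v = "u + c *s y"
    note m = u(1) mem[OF x(1)] mem[OF y(1)] alt[OF x(1)] alt[OF y(1)]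
    have S: "?u \<in> S" "?v \<in> S" "c *s y \<in> S" using m sub by (auto intro: subspace_add subspace_scale)
    have "B ?u ?u = B u u" "B ?v ?v = B u u" "B ?v ?u = B u u + B u u"
      using m S by (simp_all add: bs cxy)
    then have "?v \<in> perp_on S B {?u}" "B ?v ?v \<noteq> 0" "B ?u ?u \<noteq> 0"
      using S u dbl by (auto simp: perp_on_def)
    then show ?thesis using S by (auto simp: alternating_on_def)
  qed
qed

text \<open>Induction on the dimension. Skewness and a vector with \<open>B u u \<noteq> 0\<close>
  force \<open>1 + 1 = 0\<close>, so the form is symmetric. The disjunction is what the induction
  preserves: the complement of the last basis vector is zero, and there the form is
  alternating.\<close>

lemma orthogonal_basis_exists:
  assumes "bilinear_on S B" "subspace S" "skew_on S B" "nondegenerate_on S B"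
    and "S = {0} \<or> \<not> alternating_on S B"
  shows "\<exists>n v. is_orthogonal_basis S B n v \<and> (\<forall>i\<in>{1..n}. B (v i) (v i) \<noteq> 0)"
  using assms
proof (induction "dim S" arbitrary: S rule: less_induct)
  case less
  note bil = less.prems(1) and sub = less.prems(2)
  note bs = bilinear_on_simps[OF bil sub]
  have skew: "B u v = - B v u" if "u \<in> S" "v \<in> S" for u v
    using less.prems(3) that unfolding skew_on_def by blast
  show ?case
  proof (cases "S = {0}")
    case True
    then have "is_orthogonal_basis S B 0 (\<lambda>_. 0)"
      by (simp add: is_orthogonal_basis_def is_basis_def independent_empty)
    then show ?thesis by (metis atLeastatMost_empty_iff2 empty_iff not_one_le_zero)
  next
    case False
    then have nalt: "\<not> alternating_on S B" using less.prems(5) by blast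
    then obtain u0 where u0: "u0 \<in> S" "B u0 u0 \<noteq> 0" by (auto simp: alternating_on_def)
    have "(1 + 1) * B u0 u0 = 0"
      using skew[OF u0(1) u0(1)] by (simp add: distrib_right eq_neg_iff_add_eq_0)
    then have two: "(1::'a) + 1 = 0" using u0(2) by (metis mult_eq_0_iff)
    have sym: "B x y = B y x" if "x \<in> S" "y \<in> S" for x y
    proof -
      have "B y x + B y x = (1 + 1) * B y x" by (simp add: distrib_right)
      then have "- B y x = B y x" unfolding two by (simp add: neg_eq_iff_add_eq_0)
      then show ?thesis using skew[OF that] by simp
    qed
    have T: "bilinear_on (perp_on S B {u}) B" "subspace (perp_on S B {u})"
        "skew_on (perp_on S B {u}) B" "nondegenerate_on (perp_on S B {u}) B"
        "dim (perp_on S B {u}) < dim S"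
        "\<And>Q. span Q = perp_on S B {u} \<Longrightarrow> span ({u} \<union> Q) = S"
      if u: "u \<in> S" "B u u \<noteq> 0" for u
    proof -
      have split: "\<forall>z\<in>S. \<exists>p\<in>span {u}. z - p \<in> perp_on S B {u}"
      proof (intro ballI bexI)
        fix z assume z: "z \<in> S"
        let ?p = "(B z u / B u u) *s u"
        show "?p \<in> span {u}" by (intro span_scale span_base) auto
        show "z - ?p \<in> perp_on S B {u}"
          using z u sub by (simp add: perp_on_def subspace_diff subspace_scale bs)
      qed
      have ne: "\<not> {u} \<subseteq> {0}" "{u} \<subseteq> S" using u bs(7)[OF u(1)] by auto
      from perp_on_split[OF bil sub less.prems(3,4) ne(2,1) split]
      show "bilinear_on (perp_on S B {u}) B" "subspace (perp_on S B {u})"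
        "skew_on (perp_on S B {u}) B" "nondegenerate_on (perp_on S B {u}) B"
        "dim (perp_on S B {u}) < dim S"
        "\<And>Q. span Q = perp_on S B {u} \<Longrightarrow> span ({u} \<union> Q) = S"
        by this
    qed
    \<comment> \<open>An arbitrary anisotropic vector such as \<open>u0\<close> may have a nonzero
      alternating complement, on which the induction would stop; Albert's argument avoids
      this.\<close>
    obtain u where u: "u \<in> S" "B u u \<noteq> 0"
      and uT: "perp_on S B {u} = {0} \<or> \<not> alternating_on (perp_on S B {u}) B"
      using nonalternating_perp[OF bil sub less.prems(4) sym two nalt T(4)] by blast
    let ?T = "perp_on S B {u}"
    obtain n v where IH: "is_orthogonal_basis ?T B n v" "\<forall>i\<in>{1..n}. B (v i) (v i) \<noteq> 0"
      using less.hyps[OF T(5)[OF u] T(1-4)[OF u] uT] by blast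
    let ?v = "v(Suc n := u)"
    have spT: "span (v ` {1..n}) = ?T"
      using IH by (simp add: is_orthogonal_basis_def is_basis_def)
    have img: "?v ` {1..Suc n} = {u} \<union> v ` {1..n}" by (auto simp: atLeastAtMostSuc_conv)
    have sp: "span (?v ` {1..Suc n}) = S" unfolding img by (rule T(6)[OF u spT])
    have vT: "v i \<in> ?T" if "i \<in> {1..n}" for i
      using that span_superset[of "v ` {1..n}"] unfolding spT by auto
    have vS: "v i \<in> S" "B (v i) u = 0" "B u (v i) = 0" if "i \<in> {1..n}" for i
      using vT[OF that] sym[OF u(1), of "v i"] by (auto simp: perp_on_def)
    have off: "B (?v i) (?v j) = 0" if "i \<in> {1..Suc n}" "j \<in> {1..Suc n}" "i \<noteq> j" for i j
      using that IH vS by (auto simp: is_orthogonal_basis_def le_Suc_eq)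
    have mem: "?v i \<in> S" if "i \<in> {1..Suc n}" for i
      using that vS u by (auto simp: le_Suc_eq)
    have diag: "B (?v i) (?v i) \<noteq> 0" if i: "i \<in> {1..Suc n}" for i
      using that IH(2) u(2) by (auto simp: le_Suc_eq)
    have "is_basis S {1..Suc n} ?v"
      by (rule dual_family_is_basis[OF bil sub, where f = ?v])
        (use off mem diag sp in \<open>simp_all del: fun_upd_apply\<close>)
    then have "is_orthogonal_basis S B (Suc n) ?v"
      using off unfolding is_orthogonal_basis_def by blast
    then show ?thesis using diag by blast
  qed
qed

end

section \<open>The Wall form\<close>

context vector_space
begin

text \<open>Uniqueness follows from the other data: pairing a sum with a vector of
  \<open>U j\<close> sees only the component in \<open>U j\<close>, and regularity of
  \<open>U j\<close> then determines it.\<close>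

lemma orthogonal_decompositionI:
  assumes bil: "bilinear_on UNIV (polar q)" and fin: "finite I"
    and sub: "\<And>i. i \<in> I \<Longrightarrow> subspace (U i)" and reg: "\<And>i. i \<in> I \<Longrightarrow> regular q (U i)"
    and orth: "\<And>i j x y. i \<in> I \<Longrightarrow> j \<in> I \<Longrightarrow> i \<noteq> j \<Longrightarrow> x \<in> U i \<Longrightarrow> y \<in> U j \<Longrightarrow> polar q x y = 0"
    and ex: "\<And>x. \<exists>f\<in>Pi\<^sub>E I U. x = (\<Sum>i\<in>I. f i)"
  shows "orthogonal_decomposition UNIV q I U"
proof -
  note bs = bilinear_on_simps(5)[OF bil subspace_UNIV UNIV_I UNIV_I UNIV_I]
  have uniq: "f = g" if f: "f \<in> Pi\<^sub>E I U" and g: "g \<in> Pi\<^sub>E I U" and eq: "(\<Sum>i\<in>I. f i) = (\<Sum>i\<in>I. g i)" for f g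
  proof (rule PiE_ext[OF f g])
    fix j assume j: "j \<in> I"
    have mem: "f i \<in> U i" "g i \<in> U i" if "i \<in> I" for i using f g that by auto
    have "polar q (f j - g j) z = 0" if z: "z \<in> U j" for z
    proof -
      have pick: "polar q (\<Sum>i\<in>I. h i) z = polar q (h j) z" if h: "\<And>i. i \<in> I \<Longrightarrow> h i \<in> U i" for h
      proof -
        have "polar q (\<Sum>i\<in>I. h i) z = (\<Sum>i\<in>I. polar q (h i) z)"
          using bilinear_on_sum_left[OF bil subspace_UNIV UNIV_I UNIV_I, where c = "\<lambda>_. 1" and e = h] by simp
        also have "\<dots> = (\<Sum>i\<in>I. if i = j then polar q (h j) z else 0)"
          using h orth j z by (intro sum.cong) auto
        finally show ?thesis using fin j by simp
      qed
      show ?thesis using pick[of f] pick[of g] mem eq bs by simp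
    qed
    then have "f j - g j \<in> U j \<inter> orth_complement UNIV q (U j)"
      using mem[OF j] sub[OF j] by (auto simp: orth_complement_def subspace_diff)
    then have "f j - g j = 0" using reg[OF j] unfolding regular_def by blast
    then show "f j = g j" by simp
  qed
  show ?thesis
    unfolding orthogonal_decomposition_def using sub orth ex uniq by (metis UNIV_I subset_UNIV)
qed

end

locale unipotent_isometry = finite_dimensional_vector_space scale Basis
  for scale :: "'a::field \<Rightarrow> 'b::ab_group_add \<Rightarrow> 'b" (infixr \<open>*s\<close> 75) and Basis :: "'b set" +
  fixes q :: "'b \<Rightarrow> 'a" and \<tau> :: "'b \<Rightarrow> 'b" and W :: "'b set"
  assumes quadratic: "quadratic_space UNIV q"
    and isometry: "\<tau> \<in> orthogonal_group UNIV q"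
    and square_zero: "(\<lambda>x. \<tau> x - x) \<circ> (\<lambda>x. \<tau> x - x) = (\<lambda>_. 0)"
    and complement: "is_complement (Fix UNIV \<tau>) (Res UNIV \<tau>) W"
begin

definition \<sigma> :: "'b \<Rightarrow> 'b" where "\<sigma> x = \<tau> x - x"

abbreviation R :: "'b set" where "R \<equiv> Res UNIV \<tau>"
abbreviation \<omega> :: "'b \<Rightarrow> 'b \<Rightarrow> 'a" where "\<omega> \<equiv> wall_form UNIV q \<tau>"

lemma polar_bilinear: "bilinear_on UNIV (polar q)"
  using quadratic by (simp add: quadratic_space_def quadratic_form_on_def)

lemmas polar_simps =
  bilinear_on_simps(1,2,5,6)[OF polar_bilinear subspace_UNIV UNIV_I UNIV_I UNIV_I]
  bilinear_on_simps(3,4)[OF polar_bilinear subspace_UNIV UNIV_I UNIV_I]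
  bilinear_on_simps(7,8)[OF polar_bilinear subspace_UNIV UNIV_I]

lemmas polar_sum =
  bilinear_on_sum_left[OF polar_bilinear subspace_UNIV UNIV_I UNIV_I]
  bilinear_on_sum_right[OF polar_bilinear subspace_UNIV UNIV_I UNIV_I]

lemma polar_commute: "polar q x y = polar q y x"
  by (simp add: polar_def add.commute)

lemma polar_nondegenerate: "(\<And>y. polar q x y = 0) \<Longrightarrow> x = 0"
  using quadratic by (auto simp: quadratic_space_def regular_def orth_complement_def)

text \<open>Orthogonality of generators is extended to spans one side at a time, symmetry of the
  polar form exchanging the sides.\<close>

lemma polar_span_zero:
  assumes "\<And>x y. x \<in> A \<Longrightarrow> y \<in> B \<Longrightarrow> polar q x y = 0" "x \<in> span A" "y \<in> span B"
  shows "polar q x y = 0"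
proof -
  have "polar q x b = 0" if "b \<in> B" for b
  proof -
    have "b \<in> perp_on UNIV (polar q) A"
      using assms(1) that by (auto simp: perp_on_def polar_commute[of b])
    then show ?thesis
      using perp_on_span[OF polar_bilinear subspace_UNIV subset_UNIV _ assms(2)] polar_commute by metis
  qed
  then have "x \<in> perp_on UNIV (polar q) B" by (simp add: perp_on_def)
  then show ?thesis
    by (rule perp_on_span[OF polar_bilinear subspace_UNIV subset_UNIV _ assms(3)])
qed

section \<open>The nilpotent map \<open>\<sigma>\<close> and its image\<close>

lemma \<tau>_add: "\<tau> (x + y) = \<tau> x + \<tau> y" and \<tau>_scale: "\<tau> (c *s x) = c *s \<tau> x"
  and q_\<tau>: "q (\<tau> x) = q x" and inj_\<tau>: "inj \<tau>"
  using isometry by (auto simp: orthogonal_group_def linear_on_def bij_betw_def)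

lemma \<sigma>_add: "\<sigma> (x + y) = \<sigma> x + \<sigma> y" and \<sigma>_scale: "\<sigma> (c *s x) = c *s \<sigma> x"
  by (simp_all add: \<sigma>_def \<tau>_add \<tau>_scale scale_right_diff_distrib)

lemma \<sigma>_zero: "\<sigma> 0 = 0"
  using \<sigma>_scale[of 0 0] by simp

lemma \<sigma>_diff: "\<sigma> (x - y) = \<sigma> x - \<sigma> y"
  using \<sigma>_add[of "x - y" y] by simp

lemma \<sigma>_sum: "\<sigma> (\<Sum>i\<in>I. c i *s y i) = (\<Sum>i\<in>I. c i *s \<sigma> (y i))"
  by (induction I rule: infinite_finite_induct) (auto simp: \<sigma>_add \<sigma>_scale \<sigma>_zero)

lemma \<sigma>_\<sigma>: "\<sigma> (\<sigma> x) = 0"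
  using fun_cong[OF square_zero, of x] by (simp add: \<sigma>_def)

lemma \<tau>_eq: "\<tau> x = x + \<sigma> x" by (simp add: \<sigma>_def)

lemma R_eq: "R = range \<sigma>" by (auto simp: Res_def \<sigma>_def)

lemma Fix_iff: "x \<in> Fix S \<tau> \<longleftrightarrow> x \<in> S \<and> \<sigma> x = 0" by (simp add: Fix_def \<sigma>_def)

lemma \<sigma>_R: "u \<in> R \<Longrightarrow> \<sigma> u = 0" by (auto simp: R_eq \<sigma>_\<sigma>)

lemma subspace_R: "subspace R"
proof (rule subspaceI)
  show "0 \<in> R" unfolding R_eq by (rule range_eqI[of _ _ 0]) (simp add: \<sigma>_zero)
  show "u + v \<in> R" if "u \<in> R" "v \<in> R" for u v
    using that unfolding R_eq by (auto simp flip: \<sigma>_add)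
  show "c *s u \<in> R" if "u \<in> R" for c u
    using that unfolding R_eq by (auto simp flip: \<sigma>_scale)
qed

text \<open>Expand \<open>q (\<tau> (x + z)) = q (x + z)\<close> for a fixed vector
  \<open>z\<close>. Thus the residual space is orthogonal to the fixed space.\<close>

lemma polar_\<sigma>_fixed: "\<sigma> z = 0 \<Longrightarrow> polar q (\<sigma> x) z = 0"
  using \<tau>_add[of x z] q_\<tau>[of "x + z"] q_\<tau>[of x] q_\<tau>[of z]
  by (simp add: \<sigma>_def polar_simps) (simp add: polar_def)

lemma polar_R_fixed: "u \<in> R \<Longrightarrow> \<sigma> z = 0 \<Longrightarrow> polar q u z = 0"
  by (auto simp: R_eq polar_\<sigma>_fixed)

text \<open>When the invariance of the polar form is expanded along
  \<open>\<tau> x = x + \<sigma> x\<close>, the term with two \<open>\<sigma>\<close> vanishes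
  because \<open>\<sigma> y\<close> is fixed.\<close>

lemma polar_\<sigma>_skew: "polar q (\<sigma> x) y = - polar q x (\<sigma> y)"
proof -
  have "polar q (\<tau> x) (\<tau> y) = polar q x y"
    by (simp add: polar_def q_\<tau> \<tau>_add[symmetric])
  then show ?thesis
    by (simp add: \<tau>_eq polar_simps polar_\<sigma>_fixed \<sigma>_\<sigma> eq_neg_iff_add_eq_0 add.commute)
qed

lemma q_\<sigma>: "q (\<sigma> x) = - polar q (\<sigma> x) x"
proof -
  have "q x = q (\<sigma> x + x)" using q_\<tau>[of x] by (simp add: \<tau>_eq add.commute)
  also have "\<dots> = polar q (\<sigma> x) x + q (\<sigma> x) + q x" by (simp add: polar_def)
  finally show ?thesis by (simp add: eq_neg_iff_add_eq_0 add.commute)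
qed

text \<open>Only the second argument needs an explicit preimage. In this shape facts about the Wall
  form reduce to facts about the polar form.\<close>

lemma wall: "u \<in> R \<Longrightarrow> \<omega> u (\<sigma> y) = polar q u y"
  using wall_form_eq[OF quadratic isometry UNIV_I UNIV_I] by (auto simp: R_eq \<sigma>_def)

lemma q_R: "u \<in> R \<Longrightarrow> q u = - \<omega> u u"
  by (auto simp: R_eq wall[unfolded R_eq] q_\<sigma>)

lemma wall_bilinear: "bilinear_on R \<omega>"
proof -
  have "\<omega> (u + v) w = \<omega> u w + \<omega> v w" "\<omega> u (v + w) = \<omega> u v + \<omega> u w"
    "\<omega> (c *s u) w = c * \<omega> u w" "\<omega> u (c *s w) = c * \<omega> u w"
    if uvw: "u \<in> R" "v \<in> R" "w \<in> R" for u v w c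
  proof -
    obtain y z where yz: "v = \<sigma> y" "w = \<sigma> z" using uvw unfolding R_eq by blast
    have "u + v \<in> R" "c *s u \<in> R" using that subspace_R by (auto intro: subspace_add subspace_scale)
    then show "\<omega> (u + v) w = \<omega> u w + \<omega> v w" "\<omega> u (v + w) = \<omega> u v + \<omega> u w"
      "\<omega> (c *s u) w = c * \<omega> u w" "\<omega> u (c *s w) = c * \<omega> u w"
      using that unfolding yz \<sigma>_add[symmetric] \<sigma>_scale[symmetric]
      by (simp_all only: wall polar_simps)
  qed
  then show ?thesis by (simp add: bilinear_on_def linear_on_def)
qed

lemma wall_skew: "skew_on R \<omega>"
  unfolding skew_on_def
proof (intro ballI)
  fix u v assume "u \<in> R" "v \<in> R"
  moreover from this obtain x y where "u = \<sigma> x" "v = \<sigma> y" unfolding R_eq by blast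
  ultimately show "\<omega> u v = - \<omega> v u"
    using polar_\<sigma>_skew[of x y] polar_commute[of x "\<sigma> y"] by (simp add: wall)
qed

text \<open>The values of \<open>\<omega> u\<close> on \<open>R\<close> are the values of
  \<open>polar q u\<close> on the whole space, where the polar form is nondegenerate.\<close>

lemma wall_nondegenerate: "nondegenerate_on R \<omega>"
  using polar_nondegenerate wall unfolding nondegenerate_on_def
  by (metis R_eq rangeI)

lemma W_fixed: "w \<in> W \<Longrightarrow> \<sigma> w = 0"
  and subspace_W: "subspace W"
  and W_R: "w \<in> W \<Longrightarrow> w \<in> R \<Longrightarrow> w = 0"
  and fixed_split: "\<sigma> z = 0 \<Longrightarrow> \<exists>w\<in>W. \<exists>r\<in>R. z = w + r"
proof -
  have *: "W \<inter> R = {0}" "Fix UNIV \<tau> = {w + r |w r. w \<in> W \<and> r \<in> R}" "subspace W"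
    using complement by (auto simp: is_complement_def)
  show "subspace W" by fact
  show "w \<in> W \<Longrightarrow> w \<in> R \<Longrightarrow> w = 0" using *(1) by blast
  show "\<exists>w\<in>W. \<exists>r\<in>R. z = w + r" if "\<sigma> z = 0"
    using that *(2) Fix_iff[of z UNIV] by auto
  show "\<sigma> w = 0" if "w \<in> W"
  proof -
    have "w + 0 \<in> Fix UNIV \<tau>" unfolding *(2) using that subspace_0[OF subspace_R] by blast
    then show ?thesis by (simp add: Fix_iff)
  qed
qed

text \<open>As \<open>\<sigma>\<close> squares to zero, \<open>x - \<sigma> x\<close> is the
  preimage of \<open>x\<close> under \<open>\<tau>\<close>; it stays in \<open>S\<close>, so
  \<open>\<tau>\<close> maps \<open>S\<close> onto itself.\<close>

lemma invariant_subspace: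
  assumes sub: "subspace S" and inv: "\<tau> ` S \<subseteq> S" and reg: "regular q S"
  shows "quadratic_space S q" "\<tau> \<in> orthogonal_group S q"
proof -
  show "quadratic_space S q"
    using assms quadratic bilinear_on_subset[OF polar_bilinear subset_UNIV]
    by (simp add: quadratic_space_def quadratic_form_on_def)
  have \<sigma>S: "\<sigma> x \<in> S" if "x \<in> S" for x
    using that inv sub by (auto simp: \<sigma>_def intro!: subspace_diff)
  have "x \<in> \<tau> ` S" if "x \<in> S" for x
  proof
    show "x = \<tau> (x - \<sigma> x)" by (simp add: \<tau>_eq \<sigma>_diff \<sigma>_\<sigma>)
    show "x - \<sigma> x \<in> S" using that \<sigma>S sub by (simp add: subspace_diff)
  qed
  then have "bij_betw \<tau> S S"
    using inv inj_\<tau> by (auto simp: bij_betw_def inj_on_def)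
  then show "\<tau> \<in> orthogonal_group S q"
    by (simp add: orthogonal_group_def linear_on_def \<tau>_add \<tau>_scale q_\<tau>)
qed

end

section \<open>Decompositions from a paired basis\<close>

text \<open>One setting for both cases of the theorem: \<open>p\<close> exchanges the two vectors of
  a hyperbolic pair, or is the identity for an orthogonal basis. Indices with equal
  \<open>blk\<close> go into the same summand; numbering starts at 1 because index 0 belongs to
  \<open>W\<close>.\<close>

locale paired_basis = unipotent_isometry scale Basis q \<tau> W
  for scale :: "'a::field \<Rightarrow> 'b::ab_group_add \<Rightarrow> 'b" (infixr \<open>*s\<close> 75) and Basis :: "'b set"
    and q :: "'b \<Rightarrow> 'a" and \<tau> :: "'b \<Rightarrow> 'b" and W :: "'b set" +
  fixes I :: "'i set" and e :: "'i \<Rightarrow> 'b" and p :: "'i \<Rightarrow> 'i" and blk :: "'i \<Rightarrow> nat" and m :: nat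
  assumes finite_I: "finite I" and basis: "is_basis R I e"
    and p_mem: "i \<in> I \<Longrightarrow> p i \<in> I" and p_p: "i \<in> I \<Longrightarrow> p (p i) = i"
    and wall_zero: "i \<in> I \<Longrightarrow> j \<in> I \<Longrightarrow> j \<noteq> p i \<Longrightarrow> \<omega> (e i) (e j) = 0"
    and wall_nonzero: "i \<in> I \<Longrightarrow> \<omega> (e i) (e (p i)) \<noteq> 0"
    and blk_mem: "i \<in> I \<Longrightarrow> blk i \<in> {1..m}" and blk_p: "i \<in> I \<Longrightarrow> blk (p i) = blk i"
begin

section \<open>Preimages of the basis under \<open>\<sigma>\<close>\<close>

lemma span_e: "span (e ` I) = R"
  using basis by (simp add: is_basis_def)

lemma e_R: "i \<in> I \<Longrightarrow> e i \<in> R"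
  using span_superset[of "e ` I"] unfolding span_e by blast

text \<open>The preimages are kept variable because they are corrected twice by fixed vectors, which
  does not change their images under \<open>\<sigma>\<close>.\<close>

definition lift :: "('i \<Rightarrow> 'b) \<Rightarrow> bool" where "lift y \<longleftrightarrow> (\<forall>i\<in>I. \<sigma> (y i) = e i)"

lemma liftD: "lift y \<Longrightarrow> i \<in> I \<Longrightarrow> \<sigma> (y i) = e i" by (simp add: lift_def)

lemma lift_exists: "\<exists>y. lift y"
proof -
  have "\<exists>x. \<sigma> x = e i" if "i \<in> I" for i using e_R[OF that] by (auto simp: R_eq)
  then show ?thesis unfolding lift_def by metis
qed

lemma polar_e_lift: "lift y \<Longrightarrow> i \<in> I \<Longrightarrow> j \<in> I \<Longrightarrow> polar q (e i) (y j) = \<omega> (e i) (e j)"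
  using wall[OF e_R, of i "y j"] by (simp add: liftD)

text \<open>Pairing with the lift of the partner of \<open>j\<close> isolates the coefficient at
  \<open>j\<close>. The index set \<open>J\<close> is later all of \<open>I\<close> or a single
  block.\<close>

lemma polar_sum_e:
  assumes "lift y" "J \<subseteq> I" "j \<in> J" "p j \<in> J"
  shows "polar q (\<Sum>i\<in>J. a i *s e i) (y (p j)) = a j * \<omega> (e j) (e (p j))"
proof -
  have "polar q (\<Sum>i\<in>J. a i *s e i) (y (p j)) = (\<Sum>i\<in>J. a i * polar q (e i) (y (p j)))"
    by (rule polar_sum)
  also have "\<dots> = (\<Sum>i\<in>J. if i = j then a j * \<omega> (e j) (e (p j)) else 0)"
  proof (rule sum.cong)
    fix i assume i: "i \<in> J"
    \<comment> \<open>An involution is injective.\<close>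
    have "p j \<noteq> p i" if "i \<noteq> j" using that i assms p_p by (metis subsetD)
    then show "a i * polar q (e i) (y (p j)) = (if i = j then a j * \<omega> (e j) (e (p j)) else 0)"
      using assms i by (auto simp: polar_e_lift wall_zero subset_iff)
  qed simp
  also have "\<dots> = a j * \<omega> (e j) (e (p j))"
    using assms finite_subset[OF assms(2) finite_I] by simp
  finally show ?thesis .
qed

text \<open>Subtracting the combination of lifts with the same image under \<open>\<sigma>\<close>
  leaves a fixed vector, which splits along \<open>W\<close> and \<open>R\<close>.\<close>

lemma lift_spans:
  assumes "lift y"
  obtains b w a where "w \<in> W" "x = w + ((\<Sum>i\<in>I. a i *s e i) + (\<Sum>i\<in>I. b i *s y i))"
proof -
  have coords: "\<exists>c. u = (\<Sum>i\<in>I. c i *s e i)" if "u \<in> R" for u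
    using that span_image_finite[OF finite_I, of e] unfolding span_e by auto
  have "\<sigma> x \<in> R" by (simp add: R_eq)
  then obtain b where b: "\<sigma> x = (\<Sum>i\<in>I. b i *s e i)" using coords by blast
  have "\<sigma> (\<Sum>i\<in>I. b i *s y i) = (\<Sum>i\<in>I. b i *s e i)"
    unfolding \<sigma>_sum using assms by (intro sum.cong) (auto simp: liftD)
  then have "\<sigma> (x - (\<Sum>i\<in>I. b i *s y i)) = 0" by (simp add: \<sigma>_diff b)
  then obtain w r where wr: "w \<in> W" "r \<in> R" "x - (\<Sum>i\<in>I. b i *s y i) = w + r"
    using fixed_split by blast
  obtain a where "r = (\<Sum>i\<in>I. a i *s e i)" using coords wr(2) by blast
  then have "x = w + ((\<Sum>i\<in>I. a i *s e i) + (\<Sum>i\<in>I. b i *s y i))"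
    using wr(3) by (simp add: algebra_simps)
  then show thesis using that wr(1) by blast
qed

text \<open>\<open>Fix(\<tau>)\<^sup>\<bottom> = Res(\<tau>)\<close>, by subtracting the projection given by \<open>e\<close> and a lift of it.\<close>

lemma perp_fixed_R:
  assumes v: "\<And>z. \<sigma> z = 0 \<Longrightarrow> polar q v z = 0"
  shows "v \<in> R"
proof -
  obtain y where y: "lift y" using lift_exists by blast
  \<comment> \<open>Chosen so that \<open>r\<close> and \<open>v\<close> pair equally with every
    \<open>y (p i)\<close>; since \<open>p\<close> permutes \<open>I\<close>, these are all the
    lifts.\<close>
  define a where "a i = polar q v (y (p i)) / \<omega> (e i) (e (p i))" for i
  define r where "r = (\<Sum>i\<in>I. a i *s e i)"
  have rR: "r \<in> R" unfolding r_def using subspace_R e_R by (intro subspace_sum subspace_scale) auto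
  have rp: "polar q (v - r) (y (p j)) = 0" if "j \<in> I" for j
    using polar_sum_e[OF y subset_refl that p_mem[OF that], of a] wall_nonzero[OF that]
    by (simp add: polar_simps r_def a_def)
  have ry: "polar q (v - r) (y j) = 0" if "j \<in> I" for j
    using rp[OF p_mem[OF that]] p_p[OF that] by simp
  have rf: "polar q (v - r) z = 0" if "\<sigma> z = 0" for z
    using v[OF that] polar_R_fixed[OF rR that] by (simp add: polar_simps)
  have "polar q (v - r) x = 0" for x
  proof -
    obtain b w a where x: "w \<in> W" "x = w + ((\<Sum>i\<in>I. a i *s e i) + (\<Sum>i\<in>I. b i *s y i))"
      using lift_spans[OF y] by blast
    have "polar q (v - r) (e i) = 0" if "i \<in> I" for i
      using rf \<sigma>_R e_R that by blast
    then show ?thesis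
      using rf[OF W_fixed[OF x(1)]] ry by (simp add: x(2) polar_simps(2) polar_sum)
  qed
  then have "v - r = 0" by (rule polar_nondegenerate)
  then show ?thesis using rR by simp
qed

text \<open>A vector of \<open>W\<close> orthogonal to \<open>W\<close> is also orthogonal to
  \<open>R\<close>, hence to the whole fixed space. So it lies in \<open>R\<close>, and
  \<open>W\<close> meets \<open>R\<close> only in zero.\<close>

lemma W_nondegenerate: "nondegenerate_on W (polar q)"
  unfolding nondegenerate_on_def
proof (intro ballI impI)
  fix w assume w: "w \<in> W" and orth: "\<forall>z\<in>W. polar q w z = 0"
  show "w = 0"
  proof (rule W_R[OF w perp_fixed_R])
    fix z assume "\<sigma> z = 0"
    then obtain w' r where z: "w' \<in> W" "r \<in> R" "z = w' + r" using fixed_split by blast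
    have "polar q w r = 0"
      using polar_R_fixed[OF z(2) W_fixed[OF w]] by (simp add: polar_commute)
    then show "polar q w z = 0" using orth z(1) by (simp add: z(3) polar_simps)
  qed
qed

lemma regular_W: "regular q W"
  using W_nondegenerate subspace_0[OF subspace_W]
  by (auto simp: nondegenerate_on_def regular_def orth_complement_def polar_simps)

text \<open>The functional \<open>polar q (y i)\<close> on \<open>W\<close> is represented by some
  \<open>s i\<close> in \<open>W\<close>. Since \<open>s i\<close> is fixed,
  \<open>y i - s i\<close> is again a preimage of \<open>e i\<close>.\<close>

lemma lift_perp_W_exists: "\<exists>y. lift y \<and> (\<forall>i\<in>I. \<forall>z\<in>W. polar q (y i) z = 0)"
proof -
  obtain y where y: "lift y" using lift_exists by blast
  have "\<exists>s\<in>W. \<forall>z\<in>W. polar q s z = polar q (y i) z" for i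
  proof -
    have "linear_on scale (*) W (polar q (y i))" by (simp add: linear_on_def polar_simps)
    then show ?thesis by (rule linear_on_represented[OF polar_bilinear subspace_W W_nondegenerate])
  qed
  then obtain s where s: "s i \<in> W" "z \<in> W \<Longrightarrow> polar q (s i) z = polar q (y i) z" for i z
    by metis
  have "lift (\<lambda>i. y i - s i)"
    using y s(1) by (simp add: lift_def \<sigma>_diff W_fixed)
  then show ?thesis using s(2) by (intro exI[of _ "\<lambda>i. y i - s i"]) (simp add: polar_simps)
qed

text \<open>Adding to \<open>y\<^sub>i\<close> a combination of the \<open>e\<^sub>j\<close> changes \<open>\<bb>(y\<^sub>i, y\<^sub>k)\<close> without affecting \<open>\<sigma> y\<^sub>i\<close>; an ordering
  of \<open>I\<close> decides which of the two vectors of a pair gets corrected.\<close>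

lemma orthogonal_lift_exists:
  "\<exists>y. lift y \<and> (\<forall>i\<in>I. \<forall>z\<in>W. polar q (y i) z = 0) \<and>
     (\<forall>i\<in>I. \<forall>k\<in>I. i \<noteq> k \<longrightarrow> polar q (y i) (y k) = 0)"
proof -
  obtain y where y: "lift y" and yW: "\<And>i z. i \<in> I \<Longrightarrow> z \<in> W \<Longrightarrow> polar q (y i) z = 0"
    using lift_perp_W_exists by blast
  obtain h :: "'i \<Rightarrow> nat" where h: "inj_on h I"
    using finite_imp_inj_to_nat_seg[OF finite_I] by blast
  \<comment> \<open>With this coefficient \<open>r i\<close> pairs with \<open>y k\<close> to
    \<open>- polar q (y i) (y k)\<close> if \<open>h i < h k\<close> and to 0 otherwise, so each
    unwanted value is cancelled once, not twice.\<close>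
  define d where "d i j = (if h i < h (p j) then
    - polar q (y i) (y (p j)) / \<omega> (e j) (e (p j)) else 0)" for i j
  define r where "r i = (\<Sum>j\<in>I. d i j *s e j)" for i
  have rR: "r i \<in> R" for i
    unfolding r_def using subspace_R e_R by (intro subspace_sum subspace_scale) auto
  have rr: "polar q (r i) z = 0" if "\<sigma> z = 0" for i z
    using polar_R_fixed[OF rR that] .
  have ry: "polar q (r i) (y k) = (if h i < h k then - polar q (y i) (y k) else 0)"
    if "k \<in> I" for i k
  proof -
    have "polar q (r i) (y (p (p k))) = d i (p k) * \<omega> (e (p k)) (e (p (p k)))"
      unfolding r_def using that p_mem by (intro polar_sum_e[OF y]) auto
    then show ?thesis
      using that wall_nonzero[OF p_mem[OF that]] by (simp add: p_p d_def)
  qed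
  have "polar q (y i + r i) (y k + r k) = 0" if "i \<in> I" "k \<in> I" "i \<noteq> k" for i k
  proof -
    have "h i < h k \<or> h k < h i" using h that by (metis inj_onD linorder_neqE_nat)
    \<comment> \<open>Vectors of \<open>R\<close> are fixed, so \<open>R\<close> is orthogonal to
      itself and two corrections do not interact.\<close>
    moreover have "polar q (r i) (r k) = 0" by (rule rr[OF \<sigma>_R[OF rR]])
    ultimately show ?thesis
      using ry[OF that(2), of i] ry[OF that(1), of k] polar_commute[of "y i" "r k"] polar_commute[of "y k" "y i"]
      by (auto simp: polar_simps)
  qed
  moreover have "polar q (y i + r i) z = 0" if "i \<in> I" "z \<in> W" for i z
    using yW[OF that] rr[OF W_fixed[OF that(2)]] by (simp add: polar_simps)
  moreover have "lift (\<lambda>i. y i + r i)"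
    using y by (simp add: lift_def \<sigma>_add \<sigma>_R[OF rR])
  ultimately show ?thesis by (intro exI[of _ "\<lambda>i. y i + r i"]) blast
qed

section \<open>The blocks spanned by basis vectors and their lifts\<close>

definition J :: "nat \<Rightarrow> 'i set" where "J j = {i \<in> I. blk i = j}"

lemma J_subset: "J j \<subseteq> I" and finite_J: "finite (J j)" and J_p: "i \<in> J j \<Longrightarrow> p i \<in> J j"
  using finite_I p_mem blk_p by (auto simp: J_def)

definition block :: "('i \<Rightarrow> 'b) \<Rightarrow> nat \<Rightarrow> 'b set" where
  "block y j = span (case_sum e y ` (J j <+> J j))"

lemma block_iff:
  "x \<in> block y j \<longleftrightarrow> (\<exists>a b. x = (\<Sum>i\<in>J j. a i *s e i) + (\<Sum>i\<in>J j. b i *s y i))"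
proof -
  have "x \<in> block y j \<longleftrightarrow> (\<exists>c. x = (\<Sum>i\<in>J j <+> J j. c i *s case_sum e y i))"
    unfolding block_def using span_image_finite[of "J j <+> J j" "case_sum e y"] finite_J by auto
  also have "\<dots> \<longleftrightarrow> (\<exists>c. x = (\<Sum>i\<in>J j. c (Inl i) *s e i) + (\<Sum>i\<in>J j. c (Inr i) *s y i))"
    by (simp add: sum.Plus finite_J)
  also have "\<dots> \<longleftrightarrow> (\<exists>a b. x = (\<Sum>i\<in>J j. a i *s e i) + (\<Sum>i\<in>J j. b i *s y i))"
  proof safe
    fix a b :: "'i \<Rightarrow> 'a"
    show "\<exists>c. (\<Sum>i\<in>J j. a i *s e i) + (\<Sum>i\<in>J j. b i *s y i) =
        (\<Sum>i\<in>J j. c (Inl i) *s e i) + (\<Sum>i\<in>J j. c (Inr i) *s y i)"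
      by (rule exI[of _ "case_sum a b"]) simp
  next
    fix c :: "'i + 'i \<Rightarrow> 'a"
    show "\<exists>a b. (\<Sum>i\<in>J j. c (Inl i) *s e i) + (\<Sum>i\<in>J j. c (Inr i) *s y i) =
        (\<Sum>i\<in>J j. a i *s e i) + (\<Sum>i\<in>J j. b i *s y i)"
      by (rule exI[of _ "\<lambda>i. c (Inl i)"], rule exI[of _ "\<lambda>i. c (Inr i)"]) simp
  qed
  finally show ?thesis .
qed

lemma \<sigma>_block_sum:
  assumes "lift y"
  shows "\<sigma> ((\<Sum>i\<in>J j. a i *s e i) + (\<Sum>i\<in>J j. b i *s y i)) = (\<Sum>i\<in>J j. b i *s e i)"
proof -
  have "(\<Sum>i\<in>J j. a i *s \<sigma> (e i)) = 0"
    using J_subset \<sigma>_R e_R by (intro sum.neutral) auto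
  moreover have "(\<Sum>i\<in>J j. b i *s \<sigma> (y i)) = (\<Sum>i\<in>J j. b i *s e i)"
    using J_subset[of j] assms by (intro sum.cong) (auto simp: liftD)
  ultimately show ?thesis by (simp add: \<sigma>_add \<sigma>_sum)
qed

lemma basis_J: "inj_on e (J j)" "independent (e ` J j)"
  using basis inj_on_subset[OF _ J_subset] independent_mono[OF _ image_mono[OF J_subset]]
  unfolding is_basis_def by blast+

lemmas independent_J = independent_familyD[OF finite_J basis_J]

lemmas dim_span_e_J = dim_span_family[OF basis_J]

text \<open>Applying \<open>\<sigma>\<close> to a relation removes the \<open>e\<close> part and
  turns the \<open>y\<close> part into a relation among the \<open>e i\<close>. So the
  \<open>y\<close> coefficients vanish, and then the others do.\<close>

lemma dim_block:
  assumes "lift y"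
  shows "dim (block y j) = 2 * card (J j)"
proof -
  have zero: "\<forall>i\<in>J j <+> J j. c i = 0" if z: "(\<Sum>i\<in>J j <+> J j. c i *s case_sum e y i) = 0" for c
  proof -
    have eq: "(\<Sum>i\<in>J j. c (Inl i) *s e i) + (\<Sum>i\<in>J j. c (Inr i) *s y i) = 0"
      using z by (simp add: sum.Plus finite_J)
    then have "(\<Sum>i\<in>J j. c (Inr i) *s e i) = 0"
      using \<sigma>_block_sum[OF assms, of "\<lambda>i. c (Inl i)" j "\<lambda>i. c (Inr i)"] by (simp add: \<sigma>_zero)
    then have r: "c (Inr i) = 0" if "i \<in> J j" for i
      using independent_J[of "\<lambda>i. c (Inr i)"] that by blast
    then have "(\<Sum>i\<in>J j. c (Inl i) *s e i) = 0" using eq by simp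
    then have "c (Inl i) = 0" if "i \<in> J j" for i
      using independent_J[of "\<lambda>i. c (Inl i)"] that by blast
    with r show ?thesis by auto
  qed
  have fin: "finite (J j <+> J j)" using finite_J by simp
  have "inj_on (case_sum e y) (J j <+> J j)"
    by (rule independent_familyI(1)[OF fin]) (rule zero)
  moreover have "independent (case_sum e y ` (J j <+> J j))"
    by (rule independent_familyI(2)[OF fin]) (rule zero)
  ultimately have "dim (block y j) = card (J j <+> J j)"
    unfolding block_def by (rule dim_span_family)
  then show ?thesis using finite_J by (simp add: card_Plus)
qed

lemma Res_block:
  assumes "lift y"
  shows "Res (block y j) \<tau> = span (e ` J j)"
proof -
  have "u \<in> Res (block y j) \<tau> \<longleftrightarrow> (\<exists>b. u = (\<Sum>i\<in>J j. b i *s e i))" for u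
  proof -
    have "u \<in> Res (block y j) \<tau> \<longleftrightarrow> (\<exists>x. x \<in> block y j \<and> u = \<sigma> x)"
      by (auto simp: Res_def \<sigma>_def)
    also have "\<dots> \<longleftrightarrow> (\<exists>a b. u = \<sigma> ((\<Sum>i\<in>J j. a i *s e i) + (\<Sum>i\<in>J j. b i *s y i)))"
      unfolding block_iff by blast
    finally show ?thesis by (simp add: \<sigma>_block_sum[OF assms])
  qed
  then show ?thesis using span_image_finite[OF finite_J, of e] by auto
qed

text \<open>The \<open>y\<close> coordinates of a vector are the coordinates of its image under
  \<open>\<sigma>\<close>, so a fixed vector has none. The fixed and residual spaces of a block
  therefore coincide.\<close>

lemma Fix_block:
  assumes "lift y"
  shows "Fix (block y j) \<tau> = span (e ` J j)"
proof (intro equalityI subsetI)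
  fix x assume x: "x \<in> Fix (block y j) \<tau>"
  then obtain a b where ab: "x = (\<Sum>i\<in>J j. a i *s e i) + (\<Sum>i\<in>J j. b i *s y i)"
    by (auto simp: Fix_iff block_iff)
  have "(\<Sum>i\<in>J j. b i *s e i) = 0"
    using x \<sigma>_block_sum[OF assms, of a j b] by (simp add: Fix_iff flip: ab)
  then have "b i = 0" if "i \<in> J j" for i using independent_J that by blast
  then have "x = (\<Sum>i\<in>J j. a i *s e i)" using ab by simp
  then show "x \<in> span (e ` J j)" using span_image_finite[OF finite_J, of e] by auto
next
  fix x assume "x \<in> span (e ` J j)"
  then obtain a where a: "x = (\<Sum>i\<in>J j. a i *s e i)"
    using span_image_finite[OF finite_J, of e] by auto
  then have "x = (\<Sum>i\<in>J j. a i *s e i) + (\<Sum>i\<in>J j. 0 *s y i)" by simp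
  then have "x \<in> block y j" by (auto simp only: block_iff)
  moreover have "\<sigma> x = 0"
    unfolding a \<sigma>_sum using J_subset \<sigma>_R e_R by (intro sum.neutral) auto
  ultimately show "x \<in> Fix (block y j) \<tau>" by (simp add: Fix_iff)
qed

lemma block_invariant: "lift y \<Longrightarrow> \<tau> ` block y j \<subseteq> block y j"
proof safe
  fix x assume y: "lift y" and x: "x \<in> block y j"
  then have "\<sigma> x \<in> Res (block y j) \<tau>" by (auto simp: Res_def \<sigma>_def)
  then have "\<sigma> x \<in> Fix (block y j) \<tau>" by (simp only: Res_block[OF y] Fix_block[OF y])
  then have "\<sigma> x \<in> block y j" by (simp add: Fix_iff)
  then show "\<tau> x \<in> block y j"
    using x by (simp add: \<tau>_eq block_def span_add)
qed

text \<open>Let \<open>x\<close> be orthogonal to its block. Pairing with the \<open>e i\<close> and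
  moving \<open>\<sigma>\<close> across gives \<open>\<sigma> x = 0\<close>, so \<open>x\<close> is
  a combination of the \<open>e i\<close>; pairing with the \<open>y i\<close> then gives
  \<open>x = 0\<close>.\<close>

lemma block_regular:
  assumes y: "lift y"
  shows "regular q (block y j)"
proof -
  have "x = 0" if x: "x \<in> block y j" and orth: "\<And>z. z \<in> block y j \<Longrightarrow> polar q x z = 0" for x
  proof -
    obtain a b where ab: "x = (\<Sum>i\<in>J j. a i *s e i) + (\<Sum>i\<in>J j. b i *s y i)"
      using x by (auto simp: block_iff)
    have mem: "e i \<in> block y j" "y i \<in> block y j" if "i \<in> J j" for i
      using that unfolding block_def by (force intro!: span_base)+
    \<comment> \<open>Used for both stages: the block contains the partner of each of its indices,
      so the lifts in the block detect every coefficient.\<close>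
    have zero: "c = 0" if z: "\<And>i. i \<in> J j \<Longrightarrow> polar q (\<Sum>i\<in>J j. c' i *s e i) (y i) = 0"
        and c: "c = (\<Sum>i\<in>J j. c' i *s e i)" for c c'
    proof -
      have "c' i = 0" if i: "i \<in> J j" for i
        using polar_sum_e[OF y J_subset i J_p[OF i], of c'] z[OF J_p[OF i]] i J_subset[of j] wall_nonzero
        by auto
      then show ?thesis using c by simp
    qed
    have "\<sigma> x = 0"
    proof (rule zero)
      show "\<sigma> x = (\<Sum>i\<in>J j. b i *s e i)" unfolding ab by (rule \<sigma>_block_sum[OF y])
      then show "polar q (\<Sum>i\<in>J j. b i *s e i) (y i) = 0" if "i \<in> J j" for i
        using polar_\<sigma>_skew[of x "y i"] orth[OF mem(1)[OF that]] y that J_subset[of j]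
        by (auto simp: liftD)
    qed
    then have "x \<in> Fix (block y j) \<tau>" using x by (simp add: Fix_iff)
    then obtain c where c: "x = (\<Sum>i\<in>J j. c i *s e i)"
      unfolding Fix_block[OF y] using span_image_finite[OF finite_J, of e] by auto
    show "x = 0"
      by (rule zero[OF _ c]) (use orth mem(2) c in auto)
  qed
  then show ?thesis
    using span_zero by (auto simp: regular_def orth_complement_def block_def polar_simps)
qed

text \<open>With an orthogonal lift, generators of different blocks are orthogonal to each other and
  to \<open>W\<close>, and \<open>lift_spans\<close>, grouped by blocks, shows that the summands
  exhaust the space.\<close>

lemma block_decomposition:
  "\<exists>V. invariant_decomposition q \<tau> W m V \<and>
    (\<forall>j\<in>{1..m}. quadratic_space (V j) q \<and> \<tau> \<in> orthogonal_group (V j) q \<and>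
       dim (V j) = 2 * card (J j) \<and> Res (V j) \<tau> = span (e ` J j) \<and> Fix (V j) \<tau> = span (e ` J j))"
proof -
  obtain y where y: "lift y" and yW: "\<And>i z. i \<in> I \<Longrightarrow> z \<in> W \<Longrightarrow> polar q (y i) z = 0"
    and yy: "\<And>i k. i \<in> I \<Longrightarrow> k \<in> I \<Longrightarrow> i \<noteq> k \<Longrightarrow> polar q (y i) (y k) = 0"
    using orthogonal_lift_exists by blast
  let ?V = "block y" and ?U = "\<lambda>i. if i = 0 then W else block y i"
  have gen: "x \<in> case_sum e y ` (J j <+> J j) \<longleftrightarrow> (\<exists>i\<in>I. blk i = j \<and> (x = e i \<or> x = y i))" for x j
    by (force simp: J_def)
  have VW: "polar q x w = 0" if "x \<in> ?V j" "w \<in> W" for x w j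
  proof (rule polar_span_zero[of "case_sum e y ` (J j <+> J j)" W])
    show "polar q u v = 0" if "u \<in> case_sum e y ` (J j <+> J j)" "v \<in> W" for u v
      using that yW polar_R_fixed[OF e_R W_fixed] unfolding gen by auto
  qed (use that in \<open>auto simp: block_def span_base\<close>)
  have VV: "polar q x z = 0" if "i \<noteq> j" "x \<in> ?V i" "z \<in> ?V j" for x z i j
  proof (rule polar_span_zero[of "case_sum e y ` (J i <+> J i)" "case_sum e y ` (J j <+> J j)"])
    show "polar q u v = 0"
      if uv: "u \<in> case_sum e y ` (J i <+> J i)" "v \<in> case_sum e y ` (J j <+> J j)" for u v
    proof -
      obtain k l where kl: "k \<in> I" "l \<in> I" "blk k = i" "blk l = j" "u = e k \<or> u = y k" "v = e l \<or> v = y l"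
        using uv unfolding gen by blast
      \<comment> \<open>Since \<open>blk\<close> is constant on orbits of \<open>p\<close>, indices
        from different blocks are neither equal nor partners.\<close>
      have "l \<noteq> p k" "k \<noteq> p l" "k \<noteq> l" using kl blk_p \<open>i \<noteq> j\<close> by auto
      then have "polar q (e k) (y l) = 0" "polar q (e l) (y k) = 0" "polar q (y k) (y l) = 0"
        "polar q (e k) (e l) = 0"
        using kl(1,2) y yy by (auto simp: polar_e_lift wall_zero intro: polar_R_fixed[OF e_R \<sigma>_R[OF e_R]])
      then show ?thesis using kl(5,6) polar_commute[of "y k" "e l"] by auto
    qed
  qed (use that in \<open>auto simp: block_def\<close>)
  have sub: "subspace (?U j)" for j using subspace_W by (simp add: block_def)
  have reg: "regular q (?U j)" for j using regular_W block_regular[OF y] by simp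
  have "orthogonal_decomposition UNIV q {0..m} ?U"
  proof (rule orthogonal_decompositionI[OF polar_bilinear _ sub reg])
    show "polar q x z = 0" if "i \<noteq> j" "x \<in> ?U i" "z \<in> ?U j" for i j x z
      using that VW VV polar_commute[of x z] by (auto split: if_splits)
    fix x
    obtain b w a where x: "w \<in> W" "x = w + ((\<Sum>i\<in>I. a i *s e i) + (\<Sum>i\<in>I. b i *s y i))"
      using lift_spans[OF y] by blast
    define g where "g j = (\<Sum>i\<in>J j. a i *s e i) + (\<Sum>i\<in>J j. b i *s y i)" for j
    have grp: "(\<Sum>j\<in>{1..m}. \<Sum>i\<in>J j. h i) = (\<Sum>i\<in>I. h i)" for h :: "'i \<Rightarrow> 'b"
      unfolding J_def using finite_I blk_mem by (intro sum.group) auto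
    have "(\<Sum>j\<in>{1..m}. g j) = (\<Sum>i\<in>I. a i *s e i) + (\<Sum>i\<in>I. b i *s y i)"
      unfolding g_def sum.distrib grp ..
    moreover have "{0..m} = insert 0 {1..m}" by auto
    ultimately have sum: "x = (\<Sum>j\<in>{0..m}. if j = 0 then w else g j)"
      using x(2) by simp
    have "g j \<in> ?V j" for j unfolding g_def block_iff by blast
    then show "\<exists>f\<in>Pi\<^sub>E {0..m} ?U. x = (\<Sum>i\<in>{0..m}. f i)"
      using x(1) sum
      \<comment> \<open>\<open>restrict\<close> makes the family of components extensional, as
        \<open>Pi\<^sub>E\<close> demands.\<close>
      by (intro bexI[of _ "restrict (\<lambda>j. if j = 0 then w else g j) {0..m}"]) auto
  qed auto
  moreover have "\<tau> ` ?U j \<subseteq> ?U j" for j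
    using block_invariant[OF y] W_fixed by (auto simp: \<tau>_eq)
  ultimately have "invariant_decomposition q \<tau> W m ?V"
    unfolding invariant_decomposition_def Let_def using reg W_fixed by (simp add: \<tau>_eq)
  moreover have "quadratic_space (?V j) q" "\<tau> \<in> orthogonal_group (?V j) q" for j
    using invariant_subspace[OF _ block_invariant[OF y] block_regular[OF y]]
    by (auto simp: block_def)
  ultimately show ?thesis
    using dim_block[OF y] Res_block[OF y] Fix_block[OF y] by blast
qed

end

section \<open>The decomposition theorem\<close>

context unipotent_isometry
begin

section \<open>The alternating case\<close>

lemma hyperbolic_basis_wall:
  assumes hb: "is_hyperbolic_basis R \<omega> m x w"
    and "i \<in> {1..m} <+> {1..m}" "j \<in> {1..m} <+> {1..m}"
  shows "\<omega> (case_sum x w i) (case_sum w x j) = (if i \<noteq> j then 0 else case_sum (\<lambda>_. 1) (\<lambda>_. - 1) i)"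
  by (rule hyperbolic_gram[OF _ _ assms(2,3)])
    (rule hb[unfolded is_hyperbolic_basis_def, THEN conjunct2, THEN conjunct1]
      hb[unfolded is_hyperbolic_basis_def, THEN conjunct2, THEN conjunct2])+

lemma hyperbolic_basis_R:
  assumes "is_hyperbolic_basis R \<omega> m x w" "i \<in> {1..m}"
  shows "x i \<in> R" "w i \<in> R"
proof -
  have "span (case_sum x w ` ({1..m} <+> {1..m})) = R"
    using assms(1) by (simp add: is_hyperbolic_basis_def is_basis_def)
  then have "case_sum x w ` ({1..m} <+> {1..m}) \<subseteq> R"
    using span_superset[of "case_sum x w ` ({1..m} <+> {1..m})"] by simp
  then have "case_sum x w (Inl i) \<in> R" "case_sum x w (Inr i) \<in> R" using assms(2) by blast+
  then show "x i \<in> R" "w i \<in> R" by simp_all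
qed

text \<open>The coordinate map of the basis is the isometry; its inverse \<open>\<psi>\<close> forms
  the linear combination.\<close>

lemma hyperbolic_basis_isometric:
  fixes x w :: "nat \<Rightarrow> 'b"
  assumes hb: "is_hyperbolic_basis R \<omega> m x w"
  shows "isometric scale R \<omega> hyp_scale (hyp_space m) (hyp_form m)"
proof -
  note bs = bilinear_on_simps[OF wall_bilinear subspace_R]
  note xw = hyperbolic_basis_R[OF hb]
  \<comment> \<open>The coordinate at \<open>x i\<close> is read off with \<open>w i\<close>, the
    one at \<open>w i\<close> with \<open>x i\<close>, where
    \<open>\<omega> (w i) (x i) = - 1\<close> causes the sign.\<close>
  define \<phi> where "\<phi> v = (\<lambda>i. if i \<in> {1..m} then (\<omega> v (w i), - \<omega> v (x i)) else 0)" for v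
  define \<psi> where "\<psi> f = (\<Sum>i\<in>{1..m}. fst (f i) *s x i) + (\<Sum>i\<in>{1..m}. snd (f i) *s w i)"
    for f :: "nat \<Rightarrow> 'a \<times> 'a"
  have sum_R: "(\<Sum>i\<in>{1..m}. c i *s x i) \<in> R" "(\<Sum>i\<in>{1..m}. c i *s w i) \<in> R" for c
    using xw subspace_R by (auto intro!: subspace_sum subspace_scale)
  have \<psi>_R: "\<psi> f \<in> R" for f
    unfolding \<psi>_def using sum_R subspace_R by (simp add: subspace_add)
  have delta: "\<omega> (x i) (w k) = (if i = k then 1 else 0)" "\<omega> (w i) (x k) = (if i = k then - 1 else 0)"
      "\<omega> (x i) (x k) = 0" "\<omega> (w i) (w k) = 0"
    if "i \<in> {1..m}" "k \<in> {1..m}" for i k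
    using hb that unfolding is_hyperbolic_basis_def by metis+
  have wall_\<psi>: "\<omega> (\<psi> f) z =
      (\<Sum>i\<in>{1..m}. fst (f i) * \<omega> (x i) z) + (\<Sum>i\<in>{1..m}. snd (f i) * \<omega> (w i) z)"
    if z: "z \<in> R" for f z
  proof -
    have "\<omega> (\<Sum>i\<in>{1..m}. c i *s x i) z = (\<Sum>i\<in>{1..m}. c i * \<omega> (x i) z)"
      "\<omega> (\<Sum>i\<in>{1..m}. c i *s w i) z = (\<Sum>i\<in>{1..m}. c i * \<omega> (w i) z)" for c
      by (rule bilinear_on_sum_left[OF wall_bilinear subspace_R _ z], erule xw)+
    then show ?thesis by (simp only: \<psi>_def bs(1)[OF sum_R z])
  qed
  have coord: "\<omega> (\<psi> f) (w k) = fst (f k)" "\<omega> (\<psi> f) (x k) = - snd (f k)" if k: "k \<in> {1..m}" for f k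
  proof -
    have pick: "(\<Sum>i\<in>{1..m}. if i = k then c i else 0) = c k" for c :: "nat \<Rightarrow> 'a"
      using k by simp
    have "\<omega> (\<psi> f) (w k) = (\<Sum>i\<in>{1..m}. if i = k then fst (f i) else 0) + (\<Sum>i\<in>{1..m}. 0)"
      unfolding wall_\<psi>[OF xw(2)[OF k]] using k
      by (intro arg_cong2[of _ _ _ _ "(+)"] sum.cong) (auto simp: delta)
    then show "\<omega> (\<psi> f) (w k) = fst (f k)" unfolding pick by simp
    have "\<omega> (\<psi> f) (x k) = (\<Sum>i\<in>{1..m}. 0) + (\<Sum>i\<in>{1..m}. if i = k then - snd (f i) else 0)"
      unfolding wall_\<psi>[OF xw(1)[OF k]] using k
      by (intro arg_cong2[of _ _ _ _ "(+)"] sum.cong) (auto simp: delta)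
    then show "\<omega> (\<psi> f) (x k) = - snd (f k)" unfolding pick by simp
  qed
  have \<phi>\<psi>: "\<phi> (\<psi> f) = f" if "f \<in> hyp_space m" for f
    using that coord by (auto simp: \<phi>_def hyp_space_def fun_eq_iff)
  have \<psi>_surj: "\<exists>f\<in>hyp_space m. v = \<psi> f" if v: "v \<in> R" for v
  proof -
    have "v \<in> span (case_sum x w ` ({1..m} <+> {1..m}))"
      using hb v by (simp add: is_hyperbolic_basis_def is_basis_def)
    then obtain c where "v = (\<Sum>i\<in>{1..m} <+> {1..m}. c i *s case_sum x w i)"
      using span_image_finite[of "{1..m} <+> {1..m}" "case_sum x w"] by auto
    then have "v = (\<Sum>i\<in>{1..m}. c (Inl i) *s x i) + (\<Sum>i\<in>{1..m}. c (Inr i) *s w i)"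
      by (simp add: sum.Plus)
    then have "v = \<psi> (\<lambda>i. if i \<in> {1..m} then (c (Inl i), c (Inr i)) else 0)"
      by (simp add: \<psi>_def)
    then show ?thesis by (intro bexI) (auto simp: hyp_space_def)
  qed
  have \<psi>\<phi>: "\<psi> (\<phi> v) = v" if "v \<in> R" for v
    using \<psi>_surj[OF that] \<phi>\<psi> by auto
  have \<phi>_mem: "\<phi> v \<in> hyp_space m" for v by (simp add: \<phi>_def hyp_space_def)
  have "linear_on scale hyp_scale R \<phi>"
    unfolding linear_on_def \<phi>_def hyp_scale_def using xw
    by (auto simp: fun_eq_iff bs zero_prod_def)
  moreover have "bij_betw \<phi> R (hyp_space m)"
    by (rule bij_betw_byWitness[where f' = \<psi>]) (auto simp: \<psi>\<phi> \<phi>\<psi> \<psi>_R \<phi>_mem)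
  moreover have "hyp_form m (\<phi> u) (\<phi> v) = \<omega> u v" if u: "u \<in> R" and v: "v \<in> R" for u v
  proof -
    \<comment> \<open>Only the first argument is expanded in the basis; skewness then turns
      \<open>\<omega> (x i) v\<close> and \<open>\<omega> (w i) v\<close> into coordinates of
      \<open>v\<close>, up to sign.\<close>
    have skew: "\<omega> z v = - \<omega> v z" if "z \<in> R" for z
      using wall_skew that v unfolding skew_on_def by blast
    have "\<omega> u v = \<omega> (\<psi> (\<phi> u)) v" by (simp add: \<psi>\<phi>[OF u])
    also have "\<dots> = (\<Sum>i\<in>{1..m}. fst (\<phi> u i) * \<omega> (x i) v + snd (\<phi> u i) * \<omega> (w i) v)"
      by (simp only: wall_\<psi>[OF v] sum.distrib)
    also have "\<dots> = hyp_form m (\<phi> u) (\<phi> v)"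
      unfolding hyp_form_def
    proof (rule sum.cong)
      fix i assume i: "i \<in> {1..m}"
      show "fst (\<phi> u i) * \<omega> (x i) v + snd (\<phi> u i) * \<omega> (w i) v = hyp_plane_form (\<phi> u i) (\<phi> v i)"
        using i skew[OF xw(1)[OF i]] skew[OF xw(2)[OF i]] by (simp add: hyp_plane_form_def \<phi>_def)
    qed simp
    finally show ?thesis by simp
  qed
  ultimately show ?thesis unfolding isometric_def by blast
qed

text \<open>Here \<open>p\<close> exchanges the two copies of the index set. On the plane of
  \<open>x i\<close> and \<open>w i\<close> the form \<open>q\<close> is
  \<open>- \<omega> v v\<close>, where the cross terms \<open>a * b\<close> and
  \<open>- (b * a)\<close> cancel, so the fixed space of the block is totally isotropic.\<close>

lemma hyperbolic_decomposition:
  assumes hb: "is_hyperbolic_basis R \<omega> m x w"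
  shows "\<exists>V. invariant_decomposition q \<tau> W m V \<and>
    (\<forall>i\<in>{1..m}. dim (V i) = 4 \<and> interchange_isometry (V i) q \<tau> \<and>
       Res (V i) \<tau> = {a *s x i + b *s w i |a b. True})"
proof -
  let ?p = "case_sum Inr Inl :: nat + nat \<Rightarrow> nat + nat"
  \<comment> \<open>Rewrites the second argument to the swapped family, where the diagonal Gram
    matrix applies.\<close>
  have dual: "case_sum x w j = case_sum w x (?p j)" for j by (cases j) auto
  have pp: "?p (?p j) = j" for j by (cases j) auto
  have p_mem: "?p j \<in> {1..m} <+> {1..m}" if "j \<in> {1..m} <+> {1..m}" for j using that by auto
  interpret B: paired_basis scale Basis q \<tau> W "{1..m} <+> {1..m}" "case_sum x w" ?p "case_sum id id" m
  proof
    show "is_basis R ({1..m} <+> {1..m}) (case_sum x w)"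
      using hb by (simp add: is_hyperbolic_basis_def)
    fix i :: "nat + nat" assume i: "i \<in> {1..m} <+> {1..m}"
    then show "?p i \<in> {1..m} <+> {1..m}" "?p (?p i) = i" by (rule p_mem, intro pp)
    show "case_sum id id i \<in> {1..m}" "case_sum id id (?p i) = case_sum id id i"
      using i by auto
    show "\<omega> (case_sum x w i) (case_sum x w j) = 0" if j: "j \<in> {1..m} <+> {1..m}" "j \<noteq> ?p i" for j
    proof -
      have "i \<noteq> ?p j" using pp[of j] j(2) by metis
      then show ?thesis
        unfolding dual[of j] hyperbolic_basis_wall[OF hb i p_mem[OF j(1)]] by (rule if_P)
    qed
    show "\<omega> (case_sum x w i) (case_sum x w (?p i)) \<noteq> 0"
      unfolding dual[of "?p i"] pp hyperbolic_basis_wall[OF hb i i] using i by auto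
  qed auto
  have J: "B.J i = {Inl i, Inr i}" if "i \<in> {1..m}" for i
    unfolding B.J_def using that by auto
  have alt: "q v = 0" if v: "v \<in> span {x i, w i}" and i: "i \<in> {1..m}" for i v
  proof -
    note bs = bilinear_on_simps[OF wall_bilinear subspace_R]
    have R: "x i \<in> R" "w i \<in> R" using hyperbolic_basis_R[OF hb i] .
    obtain a b where v: "v = a *s x i + b *s w i"
      using v by (auto simp: span_breakdown_eq) (metis add.commute diff_eq_eq)
    have "a *s x i \<in> R" "b *s w i \<in> R" using R subspace_R by (auto intro: subspace_scale)
    moreover have "\<omega> (x i) (x i) = 0" "\<omega> (w i) (w i) = 0" "\<omega> (x i) (w i) = 1" "\<omega> (w i) (x i) = - 1"
      using hb i by (auto simp: is_hyperbolic_basis_def)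
    ultimately have "\<omega> v v = 0" using R subspace_R by (simp add: v bs subspace_add)
    moreover have "v \<in> R" using R subspace_R by (simp add: v subspace_add subspace_scale)
    ultimately show ?thesis by (simp add: q_R)
  qed
  have span2: "span {u, v} = {a *s u + b *s v |a b. True}" for u v
  proof -
    have "{u, v} = {u} \<union> {v}" by auto
    then show ?thesis unfolding span_Un span_singleton by (simp only: span_Un span_singleton) blast
  qed
  obtain V where V: "invariant_decomposition q \<tau> W m V"
    "\<forall>j\<in>{1..m}. quadratic_space (V j) q \<and> \<tau> \<in> orthogonal_group (V j) q \<and>
       dim (V j) = 2 * card (B.J j) \<and> Res (V j) \<tau> = span (case_sum x w ` B.J j) \<and>
       Fix (V j) \<tau> = span (case_sum x w ` B.J j)"
    using B.block_decomposition by blast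
  have "dim (V i) = 4 \<and> interchange_isometry (V i) q \<tau> \<and>
       Res (V i) \<tau> = {a *s x i + b *s w i |a b. True}" if i: "i \<in> {1..m}" for i
  proof -
    have im: "case_sum x w ` B.J i = {x i, w i}" unfolding J[OF i] by simp
    have card: "card (B.J i) = 2" unfolding J[OF i] by simp
    have Vi: "quadratic_space (V i) q" "\<tau> \<in> orthogonal_group (V i) q" "dim (V i) = 4"
      "Res (V i) \<tau> = span {x i, w i}" "Fix (V i) \<tau> = span {x i, w i}"
      using V(2)[rule_format, OF i] unfolding im card by simp_all
    have "dim (span {x i, w i}) = 2" using B.dim_span_e_J[of i] unfolding im card .
    then show ?thesis
      using Vi(1-3) alt[OF _ i] unfolding interchange_isometry_def Vi(4,5) span2[symmetric] by blast
  qed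
  then show ?thesis using V(1) by blast
qed

text \<open>Here \<open>p\<close> is the identity and each block has the single index
  \<open>i\<close>. The residual line is spanned by \<open>u i\<close>, and
  \<open>q (u i) = - \<omega> (u i) (u i)\<close> identifies \<open>\<tau>\<close> with the
  reflection.\<close>

lemma reflection_decomposition:
  assumes ob: "is_orthogonal_basis R \<omega> m u"
  shows "\<exists>V. invariant_decomposition q \<tau> W m V \<and>
    (\<forall>i\<in>{1..m}. dim (V i) = 2 \<and> is_reflection_along (V i) q (u i) \<tau>)"
proof -
  note bs = bilinear_on_simps[OF wall_bilinear subspace_R]
  have ind: "independent (u ` {1..m})" and sp: "span (u ` {1..m}) = R"
    and off: "\<And>i j. i \<in> {1..m} \<Longrightarrow> j \<in> {1..m} \<Longrightarrow> i \<noteq> j \<Longrightarrow> \<omega> (u i) (u j) = 0"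
    using ob by (auto simp: is_orthogonal_basis_def is_basis_def)
  have uR: "u i \<in> R" if "i \<in> {1..m}" for i
    using span_superset[of "u ` {1..m}"] that unfolding sp by blast
  \<comment> \<open>A basis vector with zero diagonal value would be orthogonal to the whole basis,
    against nondegeneracy.\<close>
  have diag: "\<omega> (u i) (u i) \<noteq> 0" if i: "i \<in> {1..m}" for i
  proof
    assume z: "\<omega> (u i) (u i) = 0"
    have "\<omega> (u i) v = 0" if v: "v \<in> R" for v
    proof (rule perp_on_span[OF wall_bilinear subspace_R])
      show "u i \<in> perp_on R \<omega> (u ` {1..m})"
        using off[OF i] z uR[OF i] by (auto simp: perp_on_def) (metis)
    qed (use v sp uR in auto)
    then have "u i = 0" using wall_nondegenerate uR[OF i] by (auto simp: nondegenerate_on_def)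
    then show False using ind i dependent_zero by (metis imageI)
  qed
  interpret B: paired_basis scale Basis q \<tau> W "{1..m}" u id id m
  proof
    show "is_basis R {1..m} u" using ob unfolding is_orthogonal_basis_def by (rule conjunct1)
  qed (use off diag in simp_all)
  obtain V where V: "invariant_decomposition q \<tau> W m V"
    "\<forall>j\<in>{1..m}. quadratic_space (V j) q \<and> \<tau> \<in> orthogonal_group (V j) q \<and>
       dim (V j) = 2 * card (B.J j) \<and> Res (V j) \<tau> = span (u ` B.J j) \<and>
       Fix (V j) \<tau> = span (u ` B.J j)"
    using B.block_decomposition by blast
  have "dim (V i) = 2 \<and> is_reflection_along (V i) q (u i) \<tau>" if i: "i \<in> {1..m}" for i
  proof -
    have J: "B.J i = {i}" unfolding B.J_def using i by auto
    have Vi: "dim (V i) = 2" "Res (V i) \<tau> = span {u i}" "Fix (V i) \<tau> = span {u i}"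
      using V(2)[rule_format, OF i] unfolding J by simp_all
    have qu: "q (u i) = - \<omega> (u i) (u i)" by (rule q_R[OF uR[OF i]])
    have "\<tau> v = reflection q (u i) v" if v: "v \<in> V i" for v
    proof -
      have "\<sigma> v \<in> Res (V i) \<tau>" using v by (auto simp: Res_def \<sigma>_def)
      then obtain k where k: "\<sigma> v = k *s u i" unfolding Vi span_singleton by blast
      \<comment> \<open>So \<open>k\<close> equals \<open>- polar q (u i) v / q (u i)\<close>, the
        coefficient in the reflection.\<close>
      have "polar q (u i) v = k * \<omega> (u i) (u i)"
        using wall[OF uR[OF i], of v] uR[OF i] by (simp add: k bs)
      then show ?thesis
        using diag[OF i] by (simp add: reflection_def qu \<tau>_eq k)
    qed
    moreover have "u i \<in> V i" using span_base[of "u i" "{u i}"] Vi(3) by (auto simp: Fix_iff)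
    ultimately show ?thesis using Vi(1) diag[OF i] qu by (simp add: is_reflection_along_def)
  qed
  then show ?thesis using V(1) by blast
qed

text \<open>The number \<open>m\<close> and the family \<open>V\<close> come from one basis whose
  existence was shown; the dimension of \<open>R\<close> fixes \<open>m\<close>. Every given basis
  then receives its own \<open>V'\<close>.\<close>

lemma decomposition:
  "\<exists>m V. invariant_decomposition q \<tau> W m V \<and>
    (alternating_on R \<omega> \<longrightarrow>
       2 * m = dim R \<and>
       (\<forall>i\<in>{1..m}. dim (V i) = 4 \<and> interchange_isometry (V i) q \<tau>) \<and>
       isometric scale R \<omega> hyp_scale (hyp_space m) (hyp_form m) \<and>
       (\<forall>x w. is_hyperbolic_basis R \<omega> m x w \<longrightarrow>
          (\<exists>V'. invariant_decomposition q \<tau> W m V' \<and>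
             (\<forall>i\<in>{1..m}. dim (V' i) = 4 \<and> interchange_isometry (V' i) q \<tau> \<and>
                Res (V' i) \<tau> = {a *s x i + b *s w i |a b. True})))) \<and>
    (\<not> alternating_on R \<omega> \<longrightarrow>
       m = dim R \<and>
       (\<forall>i\<in>{1..m}. dim (V i) = 2 \<and> (\<exists>u. is_reflection_along (V i) q u \<tau>)) \<and>
       (\<forall>u. is_orthogonal_basis R \<omega> m u \<longrightarrow>
          (\<exists>V'. invariant_decomposition q \<tau> W m V' \<and>
             (\<forall>i\<in>{1..m}. dim (V' i) = 2 \<and> is_reflection_along (V' i) q (u i) \<tau>))))"
proof (cases "alternating_on R \<omega>")
  case True
  then obtain m x w where hb: "is_hyperbolic_basis R \<omega> m x w"
    using hyperbolic_basis_exists[OF wall_bilinear subspace_R True wall_nondegenerate] by blast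
  have m: "2 * m = dim R"
    using hb dim_is_basis[of R "{1..m} <+> {1..m}" "case_sum x w"]
    by (simp add: is_hyperbolic_basis_def card_Plus)
  obtain V where V: "invariant_decomposition q \<tau> W m V"
    "\<forall>i\<in>{1..m}. dim (V i) = 4 \<and> interchange_isometry (V i) q \<tau>"
    using hyperbolic_decomposition[OF hb] by blast
  show ?thesis
  proof (rule exI[of _ m], rule exI[of _ V], intro conjI impI allI)
    show "\<exists>V'. invariant_decomposition q \<tau> W m V' \<and>
        (\<forall>i\<in>{1..m}. dim (V' i) = 4 \<and> interchange_isometry (V' i) q \<tau> \<and>
           Res (V' i) \<tau> = {a *s x i + b *s w i |a b. True})"
      if "is_hyperbolic_basis R \<omega> m x w" for x w
      using that by (rule hyperbolic_decomposition)
  qed (use True m V hyperbolic_basis_isometric[OF hb] in blast)+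
next
  case False
  obtain m u where ob: "is_orthogonal_basis R \<omega> m u"
    using orthogonal_basis_exists[OF wall_bilinear subspace_R wall_skew wall_nondegenerate disjI2[OF False]]
    by (elim exE conjE)
  then have "is_basis R {1..m} u" unfolding is_orthogonal_basis_def by (rule conjunct1)
  from dim_is_basis[OF this] have m: "m = dim R" by simp
  obtain V where V: "invariant_decomposition q \<tau> W m V"
    "\<forall>i\<in>{1..m}. dim (V i) = 2 \<and> is_reflection_along (V i) q (u i) \<tau>"
    using reflection_decomposition[OF ob] by blast
  show ?thesis
  proof (rule exI[of _ m], rule exI[of _ V], intro conjI impI allI)
    show "\<exists>V'. invariant_decomposition q \<tau> W m V' \<and>
        (\<forall>i\<in>{1..m}. dim (V' i) = 2 \<and> is_reflection_along (V' i) q (u i) \<tau>)"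
      if "is_orthogonal_basis R \<omega> m u" for u
      using that by (rule reflection_decomposition)
  qed (use False m V in blast)+
qed

end

theorem theorem3p10:
  fixes scale :: "'a::field \<Rightarrow> 'b::ab_group_add \<Rightarrow> 'b"
    and Basis :: "'b set"
    and q :: "'b \<Rightarrow> 'a"
    and \<tau> :: "'b \<Rightarrow> 'b"
    and W :: "'b set"
  assumes "finite_dimensional_vector_space scale Basis"
    and "vector_space.quadratic_space scale UNIV q"
    and "\<tau> \<in> vector_space.orthogonal_group scale UNIV q"
    and "(\<lambda>x. \<tau> x - x) \<circ> (\<lambda>x. \<tau> x - x) = (\<lambda>_. 0)"
    and "vector_space.is_complement scale (Fix UNIV \<tau>) (Res UNIV \<tau>) W"
  shows "\<exists>m V. vector_space.invariant_decomposition scale q \<tau> W m V \<and>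
    (alternating_on (Res UNIV \<tau>) (wall_form UNIV q \<tau>) \<longrightarrow>
       2 * m = vector_space.dim scale (Res UNIV \<tau>) \<and>
       (\<forall>i\<in>{1..m}. vector_space.dim scale (V i) = 4 \<and>
          vector_space.interchange_isometry scale (V i) q \<tau>) \<and>
       isometric scale (Res UNIV \<tau>) (wall_form UNIV q \<tau>) hyp_scale (hyp_space m) (hyp_form m) \<and>
       (\<forall>x w. vector_space.is_hyperbolic_basis scale (Res UNIV \<tau>) (wall_form UNIV q \<tau>) m x w \<longrightarrow>
          (\<exists>V'. vector_space.invariant_decomposition scale q \<tau> W m V' \<and>
             (\<forall>i\<in>{1..m}. vector_space.dim scale (V' i) = 4 \<and>
                vector_space.interchange_isometry scale (V' i) q \<tau> \<and>
                Res (V' i) \<tau> = {scale a (x i) + scale b (w i) |a b. True})))) \<and>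
    (\<not> alternating_on (Res UNIV \<tau>) (wall_form UNIV q \<tau>) \<longrightarrow>
       m = vector_space.dim scale (Res UNIV \<tau>) \<and>
       (\<forall>i\<in>{1..m}. vector_space.dim scale (V i) = 2 \<and>
          (\<exists>u. vector_space.is_reflection_along scale (V i) q u \<tau>)) \<and>
       (\<forall>u. vector_space.is_orthogonal_basis scale (Res UNIV \<tau>) (wall_form UNIV q \<tau>) m u \<longrightarrow>
          (\<exists>V'. vector_space.invariant_decomposition scale q \<tau> W m V' \<and>
             (\<forall>i\<in>{1..m}. vector_space.dim scale (V' i) = 2 \<and>
                vector_space.is_reflection_along scale (V' i) q (u i) \<tau>))))"
  by (rule unipotent_isometry.decomposition[OF unipotent_isometry.intro[OF assms(1)
        unipotent_isometry_axioms.intro[OF assms(2-5)]]])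

end
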